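(* Let $X \subset A^{\mathbb{Z}}$ (with $A$ a finite alphabet) be an infinite topologically transitive subshift of finite type, and let $X' \subset X$ be its subset of non-periodic points. Then the groups $\mathrm{Aut}(X)$ and $\mathrm{Aut}(X')$ are isomorphic.
   Context: For a finite alphabet $A$, $A^{\mathbb{Z}}$ carries the product topology of the discrete topology, and the shift is $\sigma(x)_i = x_{i+1}$. A word $u \in A^*$ occurs in $x \in A^{\mathbb{Z}}$, written $u \sqsubset x$, if $x_{[i,i+|u|-1]} = u$ for some $i \in \mathbb{Z}$; for $X \subset A^{\mathbb{Z}}$, $u \sqsubset X$ means $u \sqsubset x$ for some $x \in X$. A subshift is a set $X = \{x \in A^{\mathbb{Z}} \mid \forall u \in F: u \not\sqsubset x\}$ for some set $F \subset A^*$ of forbidden words (equivalently, a closed $\sigma$-invariant set); it is a subshift of finite type (SFT) if $F$ can be chosen finite. A subshift $X$ is (topologically) transitive if for all $u, v \sqsubset X$ there is a word $w$ with $uwv \sqsubset X$. A point $x$ is periodic if $\sigma^n(x) = x$ for some $n > 0$. For a subshift $X$, $X' = \{x \in X \mid x \text{ is not periodic}\}$, with the subspace topology and the restriction of $\sigma$ (in general non-compact). For $S = X$ or $S = X'$, $\mathrm{Aut}(S)$ is the group, under composition, of homeomorphisms $S \to S$ commuting with $\sigma$. *)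

theory Defs
  imports "HOL-Analysis.Analysis" "HOL-Algebra.Bij"
begin

type_synonym 'a config = "int \<Rightarrow> 'a"

definition shift :: "'a config \<Rightarrow> 'a config" where
  "shift x = (\<lambda>i. x (i + 1))"

definition full_shift_topology :: "'a config topology" where
  "full_shift_topology = product_topology (\<lambda>_. discrete_topology UNIV) UNIV"

definition occurs_in :: "'a list \<Rightarrow> 'a config \<Rightarrow> bool" where
  "occurs_in u x \<longleftrightarrow> (\<exists>i. \<forall>k<length u. x (i + int k) = u ! k)"

definition occurs_in_set :: "'a list \<Rightarrow> 'a config set \<Rightarrow> bool" where
  "occurs_in_set u X \<longleftrightarrow> (\<exists>x\<in>X. occurs_in u x)"

definition avoiding :: "'a list set \<Rightarrow> 'a config set" where
  "avoiding F = {x. \<forall>u\<in>F. \<not> occurs_in u x}"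

definition subshift :: "'a config set \<Rightarrow> bool" where
  "subshift X \<longleftrightarrow> (\<exists>F. X = avoiding F)"

definition subshift_of_finite_type :: "'a config set \<Rightarrow> bool" where
  "subshift_of_finite_type X \<longleftrightarrow> (\<exists>F. finite F \<and> X = avoiding F)"

definition transitive_shift :: "'a config set \<Rightarrow> bool" where
  "transitive_shift X \<longleftrightarrow>
     (\<forall>u v. occurs_in_set u X \<longrightarrow> occurs_in_set v X \<longrightarrow> (\<exists>w. occurs_in_set (u @ w @ v) X))"

definition periodic_point :: "'a config \<Rightarrow> bool" where
  "periodic_point x \<longleftrightarrow> (\<exists>n>0. (shift ^^ n) x = x)"

definition nonperiodic_part :: "'a config set \<Rightarrow> 'a config set" where
  "nonperiodic_part X = {x \<in> X. \<not> periodic_point x}"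

text \<open>Automorphisms are taken extensional, i.e. \<open>undefined\<close> outside \<open>S\<close>, so that each
  self-homeomorphism of \<open>S\<close> is represented by exactly one function.\<close>

definition shift_automorphisms :: "'a config set \<Rightarrow> ('a config \<Rightarrow> 'a config) set" where
  "shift_automorphisms S =
     {f \<in> extensional S.
        homeomorphic_map (subtopology full_shift_topology S) (subtopology full_shift_topology S) f \<and>
        (\<forall>x\<in>S. f (shift x) = shift (f x))}"

definition Aut :: "'a config set \<Rightarrow> ('a config \<Rightarrow> 'a config) monoid" where
  "Aut S = BijGroup S \<lparr>carrier := shift_automorphisms S\<rparr>"

lemma topspace_full_shift [simp]: "topspace full_shift_topology = UNIV"
  by (simp add: full_shift_topology_def)

lemma shift_automorphisms_subset_Bij: "shift_automorphisms S \<subseteq> Bij S"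
proof
  fix f assume f: "f \<in> shift_automorphisms S"
  let ?T = "subtopology full_shift_topology S"
  have "homeomorphic_map ?T ?T f" and "f \<in> extensional S"
    using f by (auto simp: shift_automorphisms_def)
  then show "f \<in> Bij S"
    using homeomorphic_imp_surjective_map[of ?T ?T f] homeomorphic_imp_injective_map[of ?T ?T f]
    by (simp add: Bij_def bij_betw_def)
qed

lemma mult_Aut:
  assumes "f \<in> carrier (Aut S)" "g \<in> carrier (Aut S)"
  shows "f \<otimes>\<^bsub>Aut S\<^esub> g = compose S f g"
  using assms shift_automorphisms_subset_Bij[of S] by (auto simp: Aut_def BijGroup_def)

lemma inv_BijGroup_eq:
  assumes "f \<in> Bij S"
  shows "inv\<^bsub>BijGroup S\<^esub> f = restrict (inv_into S f) S"
proof (rule group.inv_equality[OF group_BijGroup])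
  show "restrict (inv_into S f) S \<otimes>\<^bsub>BijGroup S\<^esub> f = \<one>\<^bsub>BijGroup S\<^esub>"
    using assms by (simp add: BijGroup_def Bij_compose_restrict_eq restrict_inv_into_Bij)
qed (use assms in \<open>auto simp: BijGroup_def restrict_inv_into_Bij\<close>)

lemma subgroup_shift_automorphisms:
  assumes inv: "shift ` S \<subseteq> S"
  shows "subgroup (shift_automorphisms S) (BijGroup S)"
proof (rule group.subgroupI[OF group_BijGroup])
  let ?T = "subtopology full_shift_topology S"
  show "shift_automorphisms S \<subseteq> carrier (BijGroup S)"
    using shift_automorphisms_subset_Bij by (simp add: BijGroup_def)
  have "homeomorphic_map ?T ?T (\<lambda>x\<in>S. x)"
    by (rule homeomorphic_map_eq[of _ _ id]) auto
  then have "(\<lambda>x\<in>S. x) \<in> shift_automorphisms S"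
    using inv by (auto simp: shift_automorphisms_def)
  then show "shift_automorphisms S \<noteq> {}" by blast
next
  let ?T = "subtopology full_shift_topology S"
  fix f assume f: "f \<in> shift_automorphisms S"
  have fB: "f \<in> Bij S" using f shift_automorphisms_subset_Bij by blast
  then have bij: "bij_betw f S S" by (simp add: Bij_def)
  have hf: "homeomorphic_map ?T ?T f" and comm: "\<And>x. x \<in> S \<Longrightarrow> f (shift x) = shift (f x)"
    using f by (auto simp: shift_automorphisms_def)
  obtain g where g: "homeomorphic_maps ?T ?T f g"
    using hf homeomorphic_map_maps by blast
  have hg: "homeomorphic_map ?T ?T g"
    using g homeomorphic_maps_map by blast
  have fg: "g y \<in> S \<and> f (g y) = y" if "y \<in> S" for y
    using g that by (auto simp: homeomorphic_maps_def continuous_map_def)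
  have eq: "inv_into S f y = g y" if "y \<in> S" for y
    using bij fg[OF that] by (metis bij_betw_inv_into_left)
  have "homeomorphic_map ?T ?T (restrict (inv_into S f) S)"
    by (rule homeomorphic_map_eq[OF hg]) (simp add: eq)
  moreover have "g (shift y) = shift (g y)" if y: "y \<in> S" for y
  proof -
    have "f (shift (g y)) = shift y" using comm fg[OF y] by simp
    moreover have "f (g (shift y)) = shift y" "g (shift y) \<in> S" "shift (g y) \<in> S"
      using fg inv y by blast+
    ultimately show ?thesis
      using bij by (metis bij_betw_inv_into_left)
  qed
  ultimately have "restrict (inv_into S f) S \<in> shift_automorphisms S"
    using inv by (auto simp: shift_automorphisms_def eq image_subset_iff)
  then show "inv\<^bsub>BijGroup S\<^esub> f \<in> shift_automorphisms S"
    by (simp add: inv_BijGroup_eq[OF fB])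
next
  let ?T = "subtopology full_shift_topology S"
  fix f g assume f: "f \<in> shift_automorphisms S" and g: "g \<in> shift_automorphisms S"
  have B: "f \<in> Bij S" "g \<in> Bij S" using f g shift_automorphisms_subset_Bij by blast+
  have "homeomorphic_map ?T ?T (f \<circ> g)"
    using f g by (auto simp: shift_automorphisms_def intro: homeomorphic_map_compose)
  then have "homeomorphic_map ?T ?T (compose S f g)"
    by (rule homeomorphic_map_eq) (simp add: compose_eq)
  moreover have "g x \<in> S" if "x \<in> S" for x
    using B(2) that Bij_imp_funcset by blast
  ultimately have "compose S f g \<in> shift_automorphisms S"
    using f g inv by (auto simp: shift_automorphisms_def compose_eq image_subset_iff)
  then show "f \<otimes>\<^bsub>BijGroup S\<^esub> g \<in> shift_automorphisms S"
    using B by (simp add: BijGroup_def)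
qed

lemma group_Aut: "shift ` S \<subseteq> S \<Longrightarrow> group (Aut S)"
  unfolding Aut_def
  by (rule subgroup.subgroup_is_group[OF subgroup_shift_automorphisms group_BijGroup])

lemma occurs_in_shift [simp]: "occurs_in u (shift x) \<longleftrightarrow> occurs_in u x"
proof
  assume "occurs_in u (shift x)"
  then obtain i where "\<forall>k<length u. x (i + int k + 1) = u ! k"
    by (auto simp: occurs_in_def shift_def)
  then have "\<forall>k<length u. x ((i + 1) + int k) = u ! k" by (simp add: ac_simps)
  then show "occurs_in u x" unfolding occurs_in_def by blast
next
  assume "occurs_in u x"
  then obtain i where "\<forall>k<length u. x (i + int k) = u ! k"
    by (auto simp: occurs_in_def)
  then have "\<forall>k<length u. shift x ((i - 1) + int k) = u ! k" by (simp add: shift_def algebra_simps)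
  then show "occurs_in u (shift x)" unfolding occurs_in_def by blast
qed

lemma shift_subshift: "subshift X \<Longrightarrow> shift ` X \<subseteq> X"
  by (auto simp: subshift_def avoiding_def)

lemma inj_shift: "inj shift"
proof (rule injI, rule ext)
  fix x y :: "'a config" and i assume "shift x = shift y"
  then have "shift x (i - 1) = shift y (i - 1)" by simp
  then show "x i = y i" by (simp add: shift_def)
qed

lemma periodic_point_shift: "periodic_point (shift x) \<longleftrightarrow> periodic_point x"
  unfolding periodic_point_def
  by (metis funpow_swap1 inj_shift injD)

lemma shift_nonperiodic_part: "shift ` X \<subseteq> X \<Longrightarrow> shift ` nonperiodic_part X \<subseteq> nonperiodic_part X"
  by (auto simp: nonperiodic_part_def periodic_point_shift)

lemma subshift_of_finite_type_imp_subshift: "subshift_of_finite_type X \<Longrightarrow> subshift X"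
  by (auto simp: subshift_of_finite_type_def subshift_def)

end

theory Submission
  imports Defs
begin

text \<open>
  Non-periodic points are dense in \<open>X\<close>, so restriction gives an injective homomorphism
  \<open>Aut X \<rightarrow> Aut X'\<close>, and everything hinges on showing that an automorphism \<open>f\<close> of \<open>X'\<close> has a limit
  at each periodic point \<open>p\<close>. By continuity of the inverse of \<open>f\<close>, the limit points of \<open>f x\<close> as \<open>x\<close>
  approaches the orbit of \<open>p\<close> are periodic. They form a closed shift-invariant set, which is finite
  because an infinite one would contain two distinct points with the same right tail. Hence there
  is a common period \<open>M\<close>, and \<open>f\<close> maps long runs of \<open>p\<close> to runs of period \<open>M\<close>. Gluing a point with
  right tail \<open>p\<close> to a point with left tail \<open>p\<close> along ever longer runs shows that all images of such
  points have one and the same tail \<open>q\<close>. If \<open>x\<close> is close to \<open>p\<close>, then shifting \<open>x\<close> to the nearest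
  place where it differs from \<open>p\<close> puts it close to a point with tail \<open>p\<close>, so the run in \<open>f x\<close> is a
  run of \<open>q\<close>; thus \<open>f x\<close> tends to \<open>q\<close>.
\<close>

section \<open>Translates, agreement on central windows, and periods\<close>

definition translate :: "int \<Rightarrow> 'a config \<Rightarrow> 'a config" where
  "translate c x = (\<lambda>i. x (i + c))"

text \<open>An integer radius combines directly with translation amounts such as
  \<open>\<bar>c\<bar>\<close> and with multiples of a period; for a negative radius the condition
  is vacuous.\<close>

definition agree :: "int \<Rightarrow> 'a config \<Rightarrow> 'a config \<Rightarrow> bool" where
  "agree n x y \<longleftrightarrow> (\<forall>i. \<bar>i\<bar> \<le> n \<longrightarrow> x i = y i)"

definition has_period :: "int \<Rightarrow> 'a config \<Rightarrow> bool" where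
  "has_period m x \<longleftrightarrow> (\<forall>i. x (i + m) = x i)"

lemma agree_refl [simp]: "agree n x x"
  by (simp add: agree_def)

lemma agree_sym: "agree n x y \<Longrightarrow> agree n y x"
  by (simp add: agree_def)

lemma agree_trans: "agree n x y \<Longrightarrow> agree n y z \<Longrightarrow> agree n x z"
  by (simp add: agree_def)

lemma agree_mono: "agree n x y \<Longrightarrow> m \<le> n \<Longrightarrow> agree m x y"
  by (simp add: agree_def)

lemma agreeD: "agree n x y \<Longrightarrow> \<bar>i\<bar> \<le> n \<Longrightarrow> x i = y i"
  by (simp add: agree_def)

lemma agree_all_eq: "(\<And>n. agree n x y) \<Longrightarrow> x = y"
  by (rule ext) (meson agree_def order_refl)

lemma agree_translate: "agree (n + \<bar>c\<bar>) x y \<Longrightarrow> agree n (translate c x) (translate c y)"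
  by (simp add: agree_def translate_def)

lemma translate_translate [simp]: "translate c (translate d x) = translate (c + d) x"
  by (simp add: translate_def ac_simps)

lemma translate_0 [simp]: "translate 0 x = x"
  by (simp add: translate_def)

lemma shift_eq_translate: "shift x = translate 1 x"
  by (simp add: shift_def translate_def)

lemma funpow_shift: "(shift ^^ n) x = translate (int n) x"
  by (induction n) (simp_all add: shift_eq_translate)

lemma has_periodD: "has_period m x \<Longrightarrow> x (i + m * k) = x i"
proof (induction k rule: int_induct[where k = 0])
  case (step1 j)
  then show ?case using has_period_def[of m x] by (metis add.assoc distrib_left mult.right_neutral)
next
  case (step2 j)
  have "x (i + m * (j - 1)) = x (i + m * (j - 1) + m)"
    using step2 by (simp add: has_period_def)
  also have "i + m * (j - 1) + m = i + m * j" by (simp add: algebra_simps)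
  finally show ?case using step2 by simp
qed simp

lemma has_period_mult: "has_period m x \<Longrightarrow> has_period (m * k) x"
  using has_periodD by (auto simp: has_period_def)

lemma has_period_translate: "has_period m x \<Longrightarrow> translate (m * k) x = x"
  by (rule ext) (simp add: translate_def has_periodD)

lemma periodic_point_iff: "periodic_point x \<longleftrightarrow> (\<exists>m>0. has_period m x)"
proof
  assume "periodic_point x"
  then obtain n where n: "n > 0" "translate (int n) x = x"
    by (auto simp: periodic_point_def funpow_shift)
  have "has_period (int n) x"
    using fun_cong[OF n(2)] by (simp add: has_period_def translate_def)
  then show "\<exists>m>0. has_period m x" using n(1) by (intro exI[of _ "int n"]) auto
next
  assume "\<exists>m>0. has_period m x"
  then obtain m where m: "m > 0" "has_period m x" by blast
  have "(shift ^^ nat m) x = x"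
    using m(1) has_period_translate[OF m(2), of 1] by (simp add: funpow_shift)
  then show "periodic_point x"
    unfolding periodic_point_def using m(1) by (metis zero_less_nat_eq)
qed

lemma periodic_point_translate: "periodic_point x \<Longrightarrow> periodic_point (translate c x)"
  unfolding periodic_point_def funpow_shift by (metis add.commute translate_translate)

lemma periodic_point_translate_iff [simp]: "periodic_point (translate c x) \<longleftrightarrow> periodic_point x"
  using periodic_point_translate[of x c] periodic_point_translate[of "translate c x" "- c"] by auto

lemma common_period:
  assumes "finite Y" "\<And>y. y \<in> Y \<Longrightarrow> periodic_point y"
  shows "\<exists>M>0. \<forall>y\<in>Y. has_period M y"
  using assms
proof (induction Y rule: finite_induct)
  case (insert y Y)
  then obtain M where M: "M > 0" "\<forall>y\<in>Y. has_period M y" by auto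
  obtain m where m: "m > 0" "has_period m y" using insert.prems periodic_point_iff by blast
  have "has_period (M * m) z" if "z \<in> insert y Y" for z
    using that M m has_period_mult[of m y M] has_period_mult[of M z m] by (auto simp: mult.commute)
  then show ?case using M m by (intro exI[of _ "M * m"]) auto
qed (auto intro: exI[of _ 1])

text \<open>Both points share a positive period, and moving any coordinate left by a large multiple
  of it lands where they agree.\<close>

lemma periodic_eq_left_tail:
  assumes "periodic_point x" "periodic_point y" "\<And>i. i < a \<Longrightarrow> x i = y i"
  shows "x = y"
proof
  fix i
  obtain M where M: "M > 0" "has_period M x" "has_period M y"
    using common_period[of "{x, y}"] assms by auto
  define k where "k = \<bar>a\<bar> + \<bar>i\<bar> + 1"
  have "1 * k \<le> M * k" using M(1) unfolding k_def by (intro mult_right_mono) auto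
  then have "i + M * (- k) < a" using k_def unfolding mult_minus_right by linarith
  then show "x i = y i" using assms(3) has_periodD M by metis
qed

lemma periodic_eq_right_tail:
  assumes "periodic_point x" "periodic_point y" "\<And>i. i > a \<Longrightarrow> x i = y i"
  shows "x = y"
proof
  fix i
  obtain M where M: "M > 0" "has_period M x" "has_period M y"
    using common_period[of "{x, y}"] assms by auto
  define k where "k = \<bar>a\<bar> + \<bar>i\<bar> + 1"
  have "1 * k \<le> M * k" using M(1) unfolding k_def by (intro mult_right_mono) auto
  then have "i + M * k > a" using k_def by linarith
  then show "x i = y i" using assms(3) has_periodD M by metis
qed

section \<open>The product topology in terms of \<open>agree\<close>, and compactness\<close>

lemma openin_full_shift_iff:
  "openin full_shift_topology W \<longleftrightarrow> (\<forall>x\<in>W. \<exists>n. \<forall>y. agree n x y \<longrightarrow> y \<in> W)"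
proof
  assume W: "openin full_shift_topology W"
  show "\<forall>x\<in>W. \<exists>n. \<forall>y. agree n x y \<longrightarrow> y \<in> W"
  proof
    fix x assume "x \<in> W"
    then obtain U where U: "finite {i. U i \<noteq> UNIV}" "x \<in> Pi\<^sub>E UNIV U" "Pi\<^sub>E UNIV U \<subseteq> W"
      using W by (auto simp: full_shift_topology_def openin_product_topology_alt)
    obtain n where n: "\<And>i. U i \<noteq> UNIV \<Longrightarrow> \<bar>i\<bar> \<le> n"
      using bdd_above_finite[OF finite_imageI[OF U(1), of abs]] by (auto simp: bdd_above_def)
    have "y \<in> W" if "agree n x y" for y
    proof -
      have "y i \<in> U i" for i
      proof (cases "U i = UNIV")
        case False
        then have "y i = x i" using agreeD[OF that n] by simp
        then show ?thesis using U(2) by auto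
      qed simp
      then show ?thesis using U(3) by auto
    qed
    then show "\<exists>n. \<forall>y. agree n x y \<longrightarrow> y \<in> W" by blast
  qed
next
  assume W: "\<forall>x\<in>W. \<exists>n. \<forall>y. agree n x y \<longrightarrow> y \<in> W"
  show "openin full_shift_topology W"
    unfolding full_shift_topology_def openin_product_topology_alt
  proof (intro ballI)
    fix x assume "x \<in> W"
    then obtain n where n: "\<And>y. agree n x y \<Longrightarrow> y \<in> W" using W by blast
    let ?U = "\<lambda>i. if \<bar>i\<bar> \<le> n then {x i} else UNIV"
    have "finite {- n..n}" by simp
    then have "finite {i. ?U i \<noteq> UNIV}" by (rule rev_finite_subset) (auto split: if_splits)
    moreover have "Pi\<^sub>E UNIV ?U \<subseteq> W"
    proof
      fix y assume "y \<in> Pi\<^sub>E UNIV ?U"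
      then have "agree n x y" unfolding agree_def by (auto simp: PiE_UNIV_domain Pi_iff split: if_splits)
      then show "y \<in> W" by (rule n)
    qed
    ultimately show "\<exists>U. finite {i \<in> UNIV. U i \<noteq> topspace (discrete_topology UNIV)} \<and>
        (\<forall>i\<in>UNIV. openin (discrete_topology UNIV) (U i)) \<and> x \<in> Pi\<^sub>E UNIV U \<and> Pi\<^sub>E UNIV U \<subseteq> W"
      by (intro exI[of _ ?U]) auto
  qed
qed

text \<open>This is continuity on \<open>S\<close>, point by point. The radius \<open>N\<close> may
  depend on \<open>x\<close>: on the non-compact \<open>X'\<close> uniform continuity cannot be
  expected.\<close>

definition locally_determined :: "'a config set \<Rightarrow> ('a config \<Rightarrow> 'a config) \<Rightarrow> bool" where
  "locally_determined S f \<longleftrightarrow> (\<forall>x\<in>S. \<forall>n. \<exists>N. \<forall>y\<in>S. agree N x y \<longrightarrow> agree n (f x) (f y))"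

lemma openin_cylinder: "openin full_shift_topology {y. agree n x y}"
  unfolding openin_full_shift_iff by (metis agree_trans mem_Collect_eq)

lemma continuous_map_iff_locally_determined:
  "continuous_map (subtopology full_shift_topology S) (subtopology full_shift_topology S) f \<longleftrightarrow>
     f \<in> S \<rightarrow> S \<and> locally_determined S f"
proof (intro iffI conjI)
  assume c: "continuous_map (subtopology full_shift_topology S) (subtopology full_shift_topology S) f"
  show fS: "f \<in> S \<rightarrow> S" using c by (auto simp: continuous_map_def)
  show "locally_determined S f"
    unfolding locally_determined_def
  proof (intro ballI allI)
    fix x n assume x: "x \<in> S"
    have "openin (subtopology full_shift_topology S) ({z. agree n (f x) z} \<inter> S)"
      using openin_cylinder by (rule openin_subtopology_Int)
    then have "openin (subtopology full_shift_topology S)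
        {y \<in> topspace (subtopology full_shift_topology S). f y \<in> {z. agree n (f x) z} \<inter> S}"
      using c unfolding continuous_map_def by blast
    then obtain T where T: "openin full_shift_topology T"
        "{y \<in> S. f y \<in> {z. agree n (f x) z} \<inter> S} = T \<inter> S"
      unfolding openin_subtopology topspace_subtopology topspace_full_shift Int_UNIV_left by blast
    have "x \<in> T" using T(2) x fS by auto
    then obtain N where "\<forall>y. agree N x y \<longrightarrow> y \<in> T" using T(1) openin_full_shift_iff by blast
    then show "\<exists>N. \<forall>y\<in>S. agree N x y \<longrightarrow> agree n (f x) (f y)" using T(2) by blast
  qed
next
  assume f: "f \<in> S \<rightarrow> S \<and> locally_determined S f"
  show "continuous_map (subtopology full_shift_topology S) (subtopology full_shift_topology S) f"
    unfolding continuous_map_def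
  proof (intro conjI allI impI)
    show "f \<in> topspace (subtopology full_shift_topology S) \<rightarrow> topspace (subtopology full_shift_topology S)"
      using f by simp
    fix U assume "openin (subtopology full_shift_topology S) U"
    then obtain T where T: "openin full_shift_topology T" "U = T \<inter> S"
      by (auto simp: openin_subtopology)
    \<comment> \<open>Values of \<open>f\<close> off \<open>S\<close> are unconstrained, so the full
      preimage of \<open>T\<close> need not be open. Instead \<open>V\<close> is a union of
      cylinders about points of \<open>S\<close>, each of whose points in \<open>S\<close> is mapped
      into \<open>T\<close>.\<close>
    define V where "V = {x. \<exists>a\<in>S. \<exists>N. agree N a x \<and> (\<forall>y\<in>S. agree N a y \<longrightarrow> f y \<in> T)}"
    have "openin full_shift_topology V"
      unfolding openin_full_shift_iff V_def using agree_trans by blast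
    moreover have "{x \<in> S. f x \<in> U} = V \<inter> S"
    proof (intro equalityI subsetI)
      fix x assume x: "x \<in> {x \<in> S. f x \<in> U}"
      then obtain n where n: "\<forall>y. agree n (f x) y \<longrightarrow> y \<in> T"
        using T openin_full_shift_iff by blast
      then obtain N where "\<forall>y\<in>S. agree N x y \<longrightarrow> agree n (f x) (f y)"
        using f x unfolding locally_determined_def by blast
      then show "x \<in> V \<inter> S" using n x unfolding V_def by (auto intro!: bexI[of _ x] exI[of _ N])
    next
      fix x assume "x \<in> V \<inter> S"
      then show "x \<in> {x \<in> S. f x \<in> U}" using f T unfolding V_def by blast
    qed
    ultimately show "openin (subtopology full_shift_topology S)
        {x \<in> topspace (subtopology full_shift_topology S). f x \<in> U}"
      by (auto simp: openin_subtopology)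
  qed
qed

lemma shift_automorphisms_iff:
  "f \<in> shift_automorphisms S \<longleftrightarrow>
     f \<in> extensional S \<and> f \<in> S \<rightarrow> S \<and> locally_determined S f \<and> (\<forall>x\<in>S. f (shift x) = shift (f x)) \<and>
     (\<exists>g\<in>S \<rightarrow> S. locally_determined S g \<and> (\<forall>x\<in>S. g (f x) = x \<and> f (g x) = x))"
  unfolding shift_automorphisms_def homeomorphic_map_maps homeomorphic_maps_def
    continuous_map_iff_locally_determined
  by auto

text \<open>Without a cluster point every \<open>z\<close> would have a cylinder that the sequence
  avoids from the index \<open>K z\<close> on. By compactness finitely many of these cover the
  space, leaving no place for terms of large index.\<close>

lemma config_cluster_point:
  fixes x :: "nat \<Rightarrow> 'a::finite config"
  shows "\<exists>z. \<forall>n K. \<exists>k\<ge>K. agree n z (x k)"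
proof (rule ccontr)
  assume "\<not> ?thesis"
  then obtain n K where nK: "\<And>z k. k \<ge> K z \<Longrightarrow> \<not> agree (n z) z (x k)" by metis
  define C where "C z = {y. agree (n z) z y}" for z
  have comp: "compact_space (full_shift_topology :: 'a config topology)"
    unfolding full_shift_topology_def compact_space_product_topology
    by (auto simp: compact_space_discrete_topology)
  have "\<exists>F. finite F \<and> F \<subseteq> range C \<and> UNIV \<subseteq> \<Union>F"
    by (rule comp[unfolded compact_space_def compactin_def, THEN conjunct2, rule_format, simplified])
      (auto simp: C_def openin_cylinder intro: agree_refl)
  then obtain Z where Z: "finite Z" "UNIV \<subseteq> \<Union>(C ` Z)"
    by (metis finite_subset_image)
  define k where "k = Max (insert 0 (K ` Z))"
  obtain z where z: "z \<in> Z" "x k \<in> C z" using Z(2) by blast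
  have "K z \<le> k" unfolding k_def using Z(1) z(1) by simp
  then show False using nK z(2) by (auto simp: C_def)
qed

text \<open>Some fixed window determines the points of \<open>Y\<close>, and a finite alphabet
  allows only finitely many patterns in it. Otherwise compactness yields two points of
  \<open>Y\<close> that differ at 0 and agree to the right of it, against
  \<open>periodic_eq_right_tail\<close>.\<close>

lemma finite_closed_periodic:
  fixes Y :: "'a::finite config set"
  assumes per: "\<And>y. y \<in> Y \<Longrightarrow> periodic_point y"
    and tr: "\<And>y c. y \<in> Y \<Longrightarrow> translate c y \<in> Y"
    and closed: "\<And>z. (\<And>n. \<exists>y\<in>Y. agree n z y) \<Longrightarrow> z \<in> Y"
  shows "finite Y"
proof -
  have "\<exists>k. \<forall>y\<in>Y. \<forall>y'\<in>Y. (\<forall>i\<in>{1..int k}. y i = y' i) \<longrightarrow> y = y'"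
  proof (rule ccontr)
    assume "\<not> ?thesis"
    then have ex: "\<exists>y\<in>Y. \<exists>y'\<in>Y. (\<forall>i\<in>{1..int k}. y i = y' i) \<and> y \<noteq> y'" for k by blast
    have "\<exists>y\<in>Y. \<exists>y'\<in>Y. (\<forall>i\<in>{1..int k}. y i = y' i) \<and> y 0 \<noteq> y' 0" for k
    proof -
      obtain y y' where y: "y \<in> Y" "y' \<in> Y" "\<forall>i\<in>{1..int k}. y i = y' i" "y \<noteq> y'"
        using ex by blast
      obtain j where j: "j < 1" "y j \<noteq> y' j"
        using periodic_eq_left_tail[of y y' 1] per y by blast
      \<comment> \<open>The disagreement at or left of 0 that is nearest to 0 sits at
        \<open>- t\<close> and is moved to 0. Each of the \<open>k\<close> coordinates after it was
        skipped by minimality of \<open>t\<close> or lies in the given window, so it is an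
        agreement.\<close>
      define t where "t = (LEAST t. y (- int t) \<noteq> y' (- int t))"
      have "y (- int (nat (- j))) \<noteq> y' (- int (nat (- j)))" using j by simp
      then have t: "y (- int t) \<noteq> y' (- int t)" unfolding t_def by (rule LeastI)
      have less: "y (- int s) = y' (- int s)" if "s < t" for s
        using not_less_Least that unfolding t_def by blast
      have "y (i - int t) = y' (i - int t)" if "i \<in> {1..int k}" for i
      proof (cases "i - int t \<ge> 1")
        case True
        then show ?thesis using y(3) that by auto
      next
        case False
        then show ?thesis using less[of "nat (int t - i)"] that by auto
      qed
      then show ?thesis
        using tr[OF y(1), of "- int t"] tr[OF y(2), of "- int t"] t
        by (intro bexI[of _ "translate (- int t) y"] bexI[of _ "translate (- int t) y'"])
          (simp_all add: translate_def)
    qed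
    then obtain a b where ab: "\<And>k. a k \<in> Y" "\<And>k. b k \<in> Y"
      "\<And>k i. i \<in> {1..int k} \<Longrightarrow> a k i = b k i" "\<And>k. a k 0 \<noteq> b k 0"
      by metis
    \<comment> \<open>Encoding the two sequences as one sequence of pairs makes them converge along
      the same indices.\<close>
    obtain z where z: "\<And>n K. \<exists>k\<ge>K. agree n z (\<lambda>i. (a k i, b k i))"
      using config_cluster_point[of "\<lambda>k i. (a k i, b k i)"] by blast
    define u v where "u = (\<lambda>i. fst (z i))" and "v = (\<lambda>i. snd (z i))"
    have uv: "\<exists>k\<ge>K. agree n u (a k) \<and> agree n v (b k)" for n K
      using z[of K n] by (force simp: agree_def u_def v_def)
    have "u \<in> Y" "v \<in> Y" using closed uv ab(1,2) by blast+
    moreover have "u i = v i" if "i > 0" for i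
    proof -
      obtain k where "k \<ge> nat i" "agree i u (a k)" "agree i v (b k)" using uv by blast
      then show ?thesis using ab(3)[of i k] that by (simp add: agree_def)
    qed
    ultimately have "u = v" using periodic_eq_right_tail[of u v 0] per by blast
    moreover obtain k where "agree 0 u (a k)" "agree 0 v (b k)" using uv by blast
    ultimately show False using ab(4)[of k] by (simp add: agree_def)
  qed
  then obtain k where k: "\<And>y y'. y \<in> Y \<Longrightarrow> y' \<in> Y \<Longrightarrow> (\<forall>i\<in>{1..int k}. y i = y' i) \<Longrightarrow> y = y'"
    by blast
  have "inj_on (\<lambda>y. restrict y {1..int k}) Y"
    using k by (intro inj_onI) (metis restrict_apply')
  moreover have "finite ((\<lambda>y. restrict y {1..int k}) ` Y)"
    by (rule finite_subset[of _ "{1..int k} \<rightarrow>\<^sub>E (UNIV :: 'a set)"]) (auto intro: finite_PiE)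
  ultimately show ?thesis using finite_imageD by blast
qed

lemma occurs_in_translate: "occurs_in u (translate c x) \<longleftrightarrow> occurs_in u x"
proof -
  have "occurs_in u x" if "occurs_in u (translate c x)" for x c
    using that unfolding occurs_in_def translate_def by (metis add.assoc add.commute)
  from this[of c x] this[of "- c" "translate c x"] show ?thesis by auto
qed

section \<open>Consequences of finite type and transitivity\<close>

locale transitive_sft =
  fixes X :: "'a::finite config set"
  assumes sft: "subshift_of_finite_type X"
    and transitive: "transitive_shift X"
    and infinite_X: "infinite X"
begin

abbreviation X' :: "'a config set" where "X' \<equiv> nonperiodic_part X"

lemma X'_iff: "x \<in> X' \<longleftrightarrow> x \<in> X \<and> \<not> periodic_point x"
  by (simp add: nonperiodic_part_def)

lemma translate_X: "x \<in> X \<Longrightarrow> translate c x \<in> X"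
  using sft by (auto simp: subshift_of_finite_type_def avoiding_def occurs_in_translate)

lemma translate_X': "x \<in> X' \<Longrightarrow> translate c x \<in> X'"
  by (simp add: X'_iff translate_X)

text \<open>An occurrence of a forbidden word fills only a finite window, so a point of
  \<open>X\<close> agreeing with \<open>z\<close> there would contain the word too.\<close>

lemma closed_X:
  assumes "\<And>n. \<exists>x\<in>X. agree n z x"
  shows "z \<in> X"
proof -
  obtain F where F: "X = avoiding F" using sft by (auto simp: subshift_of_finite_type_def)
  have "\<not> occurs_in u z" if "u \<in> F" for u
  proof
    assume "occurs_in u z"
    then obtain i where i: "\<forall>k<length u. z (i + int k) = u ! k" by (auto simp: occurs_in_def)
    obtain x where x: "x \<in> X" "agree (\<bar>i\<bar> + int (length u)) z x" using assms by blast
    have "\<forall>k<length u. x (i + int k) = u ! k" using i x(2) by (simp add: agree_def)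
    then show False using x(1) F that by (auto simp: avoiding_def occurs_in_def)
  qed
  then show ?thesis using F by (simp add: avoiding_def)
qed

text \<open>Here finiteness of the set of forbidden words enters: \<open>L\<close> bounds their
  lengths. A forbidden word starting before \<open>a\<close> ends before \<open>a + L\<close>, where
  the glued point still equals \<open>x\<close>; one starting later lies entirely in
  \<open>y\<close>.\<close>

lemma gluing:
  "\<exists>L\<ge>0. \<forall>x\<in>X. \<forall>y\<in>X. \<forall>a. (\<forall>i. a \<le> i \<longrightarrow> i < a + L \<longrightarrow> x i = y i) \<longrightarrow>
     (\<lambda>i. if i < a then x i else y i) \<in> X"
proof -
  obtain F where F: "finite F" "X = avoiding F" using sft by (auto simp: subshift_of_finite_type_def)
  define L where "L = int (Max (insert 0 (length ` F)))"
  have L: "int (length u) \<le> L" if "u \<in> F" for u using F(1) that by (simp add: L_def)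
  have "(\<lambda>i. if i < a then x i else y i) \<in> X" (is "?z \<in> X")
    if x: "x \<in> X" and y: "y \<in> X" and eq: "\<forall>i. a \<le> i \<longrightarrow> i < a + L \<longrightarrow> x i = y i" for x y a
  proof -
    have "\<not> occurs_in u ?z" if u: "u \<in> F" for u
    proof
      assume "occurs_in u ?z"
      then obtain i where i: "\<forall>k<length u. ?z (i + int k) = u ! k" by (auto simp: occurs_in_def)
      show False
      proof (cases "i < a")
        case True
        then have "x (i + int k) = u ! k" if "k < length u" for k
          using i eq L[OF u] that by (metis add_strict_mono not_less of_nat_less_iff order_less_le_trans)
        then show False using x F u by (auto simp: avoiding_def occurs_in_def)
      next
        case False
        then have "y (i + int k) = u ! k" if "k < length u" for k
          using i that by (simp split: if_splits)
        then show False using y F u by (auto simp: avoiding_def occurs_in_def)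
      qed
    qed
    then show ?thesis using F by (simp add: avoiding_def)
  qed
  moreover have "L \<ge> 0" by (simp add: L_def)
  ultimately show ?thesis by blast
qed

text \<open>Transitivity is applied to the central words of \<open>x\<close> and \<open>y\<close>,
  and the resulting point is recentred on the first of them.\<close>

lemma connecting_point:
  assumes "x \<in> X" "y \<in> X" "n \<ge> 0"
  shows "\<exists>z\<in>X. \<exists>t\<ge>0. agree n x z \<and> agree n y (translate t z)"
proof -
  \<comment> \<open>Index \<open>k\<close> of the word holds coordinate \<open>k - n\<close>; hence
    the extra \<open>n\<close> in the translations that recentre \<open>z\<close> below.\<close>
  define w where "w x = map (\<lambda>k. x (int k - n)) [0..<nat (2 * n + 1)]" for x :: "'a config"
  have w: "length (w x) = nat (2 * n + 1)" "k < nat (2 * n + 1) \<Longrightarrow> w x ! k = x (int k - n)" for x k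
    by (simp_all add: w_def)
  have "occurs_in (w x) x" for x
    unfolding occurs_in_def by (intro exI[of _ "- n"]) (simp add: w)
  then obtain v where "occurs_in_set (w x @ v @ w y) X"
    using transitive assms unfolding transitive_shift_def occurs_in_set_def by blast
  then obtain z i where z: "z \<in> X"
      "\<And>k. k < length (w x @ v @ w y) \<Longrightarrow> z (i + int k) = (w x @ v @ w y) ! k"
    by (auto simp: occurs_in_set_def occurs_in_def)
  have 1: "agree n x (translate (i + n) z)"
    unfolding agree_def
  proof (intro allI impI)
    fix j assume j: "\<bar>j\<bar> \<le> n"
    then have l: "nat (j + n) < nat (2 * n + 1)" "0 \<le> j + n" by auto
    then have "z (i + int (nat (j + n))) = x (int (nat (j + n)) - n)"
      using z(2)[of "nat (j + n)"] l by (simp add: w nth_append trans_less_add1 del: int_nat_eq)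
    then show "x j = translate (i + n) z j"
      using l(2) by (simp add: translate_def ac_simps)
  qed
  define s where "s = int (length (w x @ v))"
  have 2: "agree n y (translate (i + s + n) z)"
    unfolding agree_def
  proof (intro allI impI)
    fix j assume j: "\<bar>j\<bar> \<le> n"
    then have l: "nat (j + n) < nat (2 * n + 1)" "0 \<le> j + n" by auto
    have "z (i + int (length (w x @ v) + nat (j + n))) = w y ! nat (j + n)"
      using z(2)[of "length (w x @ v) + nat (j + n)"] l w(1)[of y]
      by (metis append_assoc length_append nat_add_left_cancel_less nth_append_length_plus)
    then show "y j = translate (i + s + n) z j"
      using j l by (simp add: w s_def translate_def algebra_simps)
  qed
  show ?thesis
    using 1 2 z(1) translate_X
    by (intro bexI[of _ "translate (i + n) z"] exI[of _ s]) (simp_all add: s_def ac_simps)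
qed

end

text \<open>The orbit of \<open>p\<close> consists of the translates by \<open>0\<close> to
  \<open>m - 1\<close>, so one window contains a difference from each of them.\<close>

lemma not_in_orbit_apart:
  assumes "has_period m p" "m > 0" "\<And>c. x \<noteq> translate c p"
  shows "\<exists>n\<ge>0. \<forall>c. \<not> agree n x (translate c p)"
proof -
  have "\<exists>i. x i \<noteq> translate c p i" for c using assms(3) by blast
  then obtain i where i: "\<And>c. x (i c) \<noteq> translate c p (i c)" by metis
  define n where "n = Max ((\<lambda>c. \<bar>i c\<bar>) ` {0..<m})"
  have n: "\<bar>i c\<bar> \<le> n" if "c \<in> {0..<m}" for c
    unfolding n_def using that by (intro Max_ge) auto
  have "\<not> agree n x (translate c p)" for c
  proof
    assume a: "agree n x (translate c p)"
    have "translate c p = translate (c mod m) (translate (m * (c div m)) p)" by simp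
    also have "\<dots> = translate (c mod m) p" by (simp only: has_period_translate[OF assms(1)])
    finally have "agree n x (translate (c mod m) p)" using a by simp
    then show False using i[of "c mod m"] n[of "c mod m"] assms(2) by (simp add: agree_def)
  qed
  moreover have "n \<ge> 0" using n[of 0] assms(2) by simp
  ultimately show ?thesis by blast
qed

context transitive_sft
begin

lemma point_outside_orbit:
  assumes "has_period m p" "m > 0"
  shows "\<exists>x\<in>X. \<forall>c. x \<noteq> translate c p"
proof (rule ccontr)
  assume "\<not> ?thesis"
  then have "X \<subseteq> range (\<lambda>c. translate c p)" by blast
  also have "\<dots> \<subseteq> (\<lambda>c. translate c p) ` {0..<m}"
  proof clarify
    fix c
    have "translate c p = translate (c mod m) (translate (m * (c div m)) p)" by simp
    also have "\<dots> = translate (c mod m) p" by (simp only: has_period_translate[OF assms(1)])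
    finally show "translate c p \<in> (\<lambda>c. translate c p) ` {0..<m}" using assms(2) by auto
  qed
  finally show False using infinite_X finite_subset by blast
qed

text \<open>A connecting point between \<open>p\<close> and a point \<open>x\<close> off its orbit
  has one side replaced by \<open>p\<close>. If the result were periodic, its tail would force it to
  be \<open>p\<close>, yet it still shows a window of \<open>x\<close> that occurs in no translate
  of \<open>p\<close>.\<close>

lemma nonperiodic_with_periodic_tail:
  assumes "p \<in> X" "has_period m p" "m > 0"
  shows "\<exists>x\<in>X'. \<exists>a. \<forall>i\<ge>a. x i = p i" and "\<exists>y\<in>X'. \<exists>b. \<forall>i\<le>b. y i = p i"
proof -
  have pp: "periodic_point p" using assms periodic_point_iff by blast
  obtain x where x: "x \<in> X" "\<And>c. x \<noteq> translate c p" using point_outside_orbit assms by blast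
  then obtain k where k: "k \<ge> 0" "\<And>c. \<not> agree k x (translate c p)"
    using not_in_orbit_apart[of m p x] assms by blast
  obtain L where L: "L \<ge> 0" "\<And>x y a. x \<in> X \<Longrightarrow> y \<in> X \<Longrightarrow> (\<And>i. a \<le> i \<Longrightarrow> i < a + L \<Longrightarrow> x i = y i) \<Longrightarrow>
     (\<lambda>i. if i < a then x i else y i) \<in> X" using gluing by metis
  \<comment> \<open>The window needs \<open>k\<close> coordinates to separate \<open>x\<close> from
    the orbit and \<open>L\<close> coordinates of overlap for gluing.\<close>
  define n where "n = k + L"
  have n: "n \<ge> 0" "k \<le> n" "L \<le> n" using k(1) L(1) by (auto simp: n_def)
  show "\<exists>x\<in>X'. \<exists>a. \<forall>i\<ge>a. x i = p i"
  proof -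
    obtain z t where z: "z \<in> X" "t \<ge> 0" "agree n x z" "agree n p (translate t z)"
      using connecting_point[OF x(1) assms(1) n(1)] by blast
    define x0 where "x0 = (\<lambda>i. if i < 0 then translate t z i else p i)"
    have "x0 \<in> X"
      unfolding x0_def using z n translate_X assms(1) by (intro L(2)) (auto simp: agree_def)
    have x0: "x0 i = translate t z i" if "i \<le> n" for i
      using z(4) n(1) that by (simp add: x0_def agree_def)
    have "\<not> periodic_point x0"
    proof
      assume "periodic_point x0"
      then have "x0 = p" using pp by (rule periodic_eq_right_tail[where a = 0]) (simp add: x0_def)
      then have "x i = p (i - t)" if "\<bar>i\<bar> \<le> n" for i
        using agreeD[OF z(3) that] x0[of "i - t"] that z(2) by (simp add: translate_def)
      then have "agree k x (translate (- t) p)" using n(2) by (simp add: agree_def translate_def)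
      then show False using k by blast
    qed
    then show ?thesis
      using \<open>x0 \<in> X\<close> by (intro bexI[of _ x0] exI[of _ 0]) (auto simp: X'_iff x0_def)
  qed
  show "\<exists>y\<in>X'. \<exists>b. \<forall>i\<le>b. y i = p i"
  proof -
    obtain z t where z: "z \<in> X" "t \<ge> 0" "agree n p z" "agree n x (translate t z)"
      using connecting_point[OF assms(1) x(1) n(1)] by blast
    define y0 where "y0 = (\<lambda>i. if i < - n then p i else z i)"
    have "y0 \<in> X"
      unfolding y0_def using z n assms(1) by (intro L(2)) (auto simp: agree_def)
    have "\<not> periodic_point y0"
    proof
      assume "periodic_point y0"
      then have "y0 = p" using pp by (rule periodic_eq_left_tail[where a = "- n"]) (simp add: y0_def)
      moreover have "y0 (i + t) = z (i + t)" if "\<bar>i\<bar> \<le> n" for i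
      proof -
        have "- n \<le> i + t" using that z(2) by linarith
        then show ?thesis by (simp add: y0_def)
      qed
      ultimately have "x i = p (i + t)" if "\<bar>i\<bar> \<le> n" for i
        using agreeD[OF z(4) that] that by (simp add: translate_def)
      then have "agree k x (translate t p)" using n(2) by (simp add: agree_def translate_def)
      then show False using k by blast
    qed
    then show ?thesis
      using \<open>y0 \<in> X\<close> by (intro bexI[of _ y0] exI[of _ "- n - 1"]) (auto simp: X'_iff y0_def)
  qed
qed

end

section \<open>Images of periodic runs under an automorphism of the non-periodic part\<close>

locale nonperiodic_automorphism = transitive_sft X for X :: "'a::finite config set" +
  fixes f g :: "'a config \<Rightarrow> 'a config"
  assumes f_X': "x \<in> X' \<Longrightarrow> f x \<in> X'" and g_X': "x \<in> X' \<Longrightarrow> g x \<in> X'"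
    and f_local: "locally_determined X' f" and g_local: "locally_determined X' g"
    and g_f: "x \<in> X' \<Longrightarrow> g (f x) = x" and f_g: "x \<in> X' \<Longrightarrow> f (g x) = x"
    and f_shift: "x \<in> X' \<Longrightarrow> f (shift x) = shift (f x)"
begin

lemma f_translate:
  assumes "x \<in> X'"
  shows "f (translate c x) = translate c (f x)"
proof (induction c rule: int_induct[where k = 0])
  case (step1 i)
  have "f (translate (i + 1) x) = f (shift (translate i x))"
    by (simp add: shift_eq_translate add.commute)
  also have "\<dots> = translate (i + 1) (f x)"
    using step1 f_shift[OF translate_X'[OF assms, of i]] by (simp add: shift_eq_translate add.commute)
  finally show ?case .
next
  case (step2 i)
  have "translate i (f x) = f (shift (translate (i - 1) x))"
    using step2 by (simp add: shift_eq_translate)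
  also have "\<dots> = shift (f (translate (i - 1) x))"
    by (rule f_shift[OF translate_X'[OF assms]])
  finally have "translate (- 1) (translate i (f x)) = translate (- 1) (shift (f (translate (i - 1) x)))"
    by simp
  then show ?case by (simp add: shift_eq_translate)
qed simp

text \<open>Otherwise \<open>g\<close>, being continuous at \<open>z\<close>, would send a neighbourhood of \<open>z\<close> away from the
  orbit of \<open>p\<close>.\<close>

lemma limit_at_orbit_periodic:
  assumes p: "has_period m p" "m > 0"
    and z: "\<And>n k. \<exists>x\<in>X'. \<exists>c. agree k x (translate c p) \<and> agree n z (f x)"
  shows "periodic_point z"
proof (rule ccontr)
  assume "\<not> periodic_point z"
  moreover have "z \<in> X" using closed_X z f_X' X'_iff by metis
  ultimately have zX: "z \<in> X'" by (simp add: X'_iff)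
  have "g z \<noteq> translate c p" for c
    using g_X'[OF zX] p periodic_point_iff X'_iff periodic_point_translate by metis
  then obtain k where k: "\<And>c. \<not> agree k (g z) (translate c p)"
    using not_in_orbit_apart[OF p] by blast
  obtain N where N: "\<And>y. y \<in> X' \<Longrightarrow> agree N z y \<Longrightarrow> agree k (g z) (g y)"
    using g_local zX unfolding locally_determined_def by blast
  obtain x c where x: "x \<in> X'" "agree k x (translate c p)" "agree N z (f x)" using z by blast
  have "agree k (g z) x" using N[OF f_X'[OF x(1)] x(3)] g_f[OF x(1)] by simp
  then show False using k x(2) agree_trans by blast
qed

text \<open>The limit points of images near the orbit form a finite set with a common period
  \<open>M\<close>, and by compactness images of points sufficiently near the orbit already show
  this period at the origin.\<close>

lemma run_step:
  assumes p: "has_period m p" "m > 0"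
  shows "\<exists>M>0. \<exists>C\<ge>0. has_period M p \<and>
    (\<forall>x\<in>X'. \<forall>c. agree C x (translate c p) \<longrightarrow> f x M = f x 0)"
proof -
  define Y where "Y = {z. \<forall>n k. \<exists>x\<in>X'. \<exists>c. agree k x (translate c p) \<and> agree n z (f x)}"
  have per: "periodic_point z" if "z \<in> Y" for z
    using limit_at_orbit_periodic[OF p] that by (simp add: Y_def)
  have "finite Y"
  proof (rule finite_closed_periodic[OF per])
    fix z c assume z: "z \<in> Y"
    have "\<exists>x\<in>X'. \<exists>d. agree k x (translate d p) \<and> agree n (translate c z) (f x)" for n k
    proof -
      obtain x d where "x \<in> X'" "agree (k + \<bar>c\<bar>) x (translate d p)" "agree (n + \<bar>c\<bar>) z (f x)"
        using z unfolding Y_def by blast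
      then show ?thesis
        using agree_translate[of k c x] agree_translate[of n c z] translate_X' f_translate
        by (metis translate_translate)
    qed
    then show "translate c z \<in> Y" by (simp add: Y_def)
  next
    fix z assume z: "\<And>n. \<exists>y\<in>Y. agree n z y"
    have "\<exists>x\<in>X'. \<exists>c. agree k x (translate c p) \<and> agree n z (f x)" for n k
    proof -
      obtain y where "y \<in> Y" "agree n z y" using z by blast
      then show ?thesis unfolding Y_def using agree_trans by blast
    qed
    then show "z \<in> Y" by (simp add: Y_def)
  qed
  moreover have "periodic_point p" using p periodic_point_iff by blast
  \<comment> \<open>Including \<open>p\<close> makes \<open>M\<close> a period of \<open>p\<close>
    as well, so that moving by multiples of \<open>M\<close> later preserves its phase.\<close>
  ultimately obtain M where M: "M > 0" "\<And>z. z \<in> insert p Y \<Longrightarrow> has_period M z"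
    using common_period[of "insert p Y"] per by auto
  have "\<exists>C\<ge>0. \<forall>x\<in>X'. \<forall>c. agree C x (translate c p) \<longrightarrow> f x M = f x 0"
  proof (rule ccontr)
    assume "\<not> ?thesis"
    \<comment> \<open>If every radius fails, the counterexamples approach the orbit. A cluster point
      of their images lies in \<open>Y\<close>, hence has period \<open>M\<close>, which contradicts
      the failure at coordinates \<open>0\<close> and \<open>M\<close>.\<close>
    then have "\<exists>x\<in>X'. \<exists>c. agree (int k) x (translate c p) \<and> f x M \<noteq> f x 0" for k
      by (metis of_nat_0_le_iff)
    then obtain x c where x: "\<And>k. x k \<in> X'" "\<And>k. agree (int k) (x k) (translate (c k) p)"
      "\<And>k. f (x k) M \<noteq> f (x k) 0" by metis
    obtain z where z: "\<And>n K. \<exists>k\<ge>K. agree n z (f (x k))"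
      using config_cluster_point[of "\<lambda>k. f (x k)"] by blast
    have "\<exists>y\<in>X'. \<exists>c. agree k y (translate c p) \<and> agree n z (f y)" for n k
    proof -
      obtain l where l: "l \<ge> nat k" "agree n z (f (x l))" using z by blast
      have "agree k (x l) (translate (c l) p)" using agree_mono[OF x(2)[of l]] l(1) by simp
      then show ?thesis using x(1) l(2) by blast
    qed
    then have "z \<in> Y" by (simp add: Y_def)
    then have "z (0 + M) = z 0" using M(2)[of z] unfolding has_period_def by blast
    then have "z M = z 0" by simp
    moreover obtain k where "agree M z (f (x k))" using z by blast
    ultimately show False using x(3)[of k] M(1) by (simp add: agree_def)
  qed
  then show ?thesis using M by blast
qed

text \<open>Translating any coordinate of the run to the origin reduces a single step of length
  \<open>M\<close> to \<open>run_step\<close>; the margin \<open>C\<close> keeps the required window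
  inside the run.\<close>

lemma periodic_run:
  assumes p: "has_period m p" "m > 0"
  shows "\<exists>M>0. \<exists>C\<ge>0. has_period M p \<and> (\<forall>x\<in>X'. \<forall>a b. (\<forall>k. a \<le> k \<longrightarrow> k \<le> b \<longrightarrow> x k = p k) \<longrightarrow>
    (\<forall>i\<in>{a + C..b - C}. \<forall>t. i + M * t \<in> {a + C..b - C} \<longrightarrow> f x (i + M * t) = f x i))"
proof -
  obtain M C where M: "M > 0" "has_period M p" and C: "C \<ge> 0"
    "\<And>x c. x \<in> X' \<Longrightarrow> agree C x (translate c p) \<Longrightarrow> f x M = f x 0"
    using run_step[OF p] by blast
  have "f x (i + M * t) = f x i"
    if x: "x \<in> X'" and run: "\<forall>k. a \<le> k \<longrightarrow> k \<le> b \<longrightarrow> x k = p k"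
      and i: "i \<in> {a + C..b - C}" and it: "i + M * t \<in> {a + C..b - C}" for x a b i t
  proof -
    have step: "f x (j + M) = f x j" if "j \<in> {a + C..b - C}" for j
    proof -
      have "agree C (translate j x) (translate j p)"
        using run that by (auto simp: agree_def translate_def abs_le_iff)
      then have "f (translate j x) M = f (translate j x) 0" using C(2) translate_X' x by blast
      then have "translate j (f x) M = translate j (f x) 0" using f_translate[OF x] by simp
      then show ?thesis by (simp add: translate_def add.commute)
    qed
    have steps: "f x (j + M * int s) = f x j"
      if "j \<in> {a + C..b - C}" "j + M * int s \<in> {a + C..b - C}" for j s
      using that(2)
    proof (induction s)
      case (Suc s)
      have "0 \<le> M * int s" using M(1) by simp
      moreover have "j + M * int (Suc s) = j + M * int s + M" by (simp add: algebra_simps)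
      ultimately have "a + C \<le> j + M * int s" "j + M * int s \<le> b - C"
        using Suc.prems that(1) M(1) unfolding atLeastAtMost_iff by linarith+
      then have "j + M * int s \<in> {a + C..b - C}" by simp
      then have "f x (j + M * int s + M) = f x j" using step Suc.IH by simp
      then show ?case by (simp add: algebra_simps)
    qed simp
    show ?thesis
    \<comment> \<open>For negative \<open>t\<close> the two coordinates exchange roles.\<close>
    proof (cases "t \<ge> 0")
      case True
      then show ?thesis using steps[of i "nat t"] i it by simp
    next
      case False
      then show ?thesis using steps[of "i + M * t" "nat (- t)"] i it by simp
    qed
  qed
  then show ?thesis using M C(1) by blast
qed

section \<open>The limit at a fixed periodic point \<open>p\<close>, with the constants of
  \<open>periodic_run\<close>\<close>

context
  fixes p :: "'a config" and M C :: int
  assumes p_X: "p \<in> X" and M_pos: "M > 0" and C_nonneg: "C \<ge> 0" and p_period: "has_period M p"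
    and run: "\<And>x a b i t. x \<in> X' \<Longrightarrow> (\<And>k. a \<le> k \<Longrightarrow> k \<le> b \<Longrightarrow> x k = p k) \<Longrightarrow>
      i \<in> {a + C..b - C} \<Longrightarrow> i + M * t \<in> {a + C..b - C} \<Longrightarrow> f x (i + M * t) = f x i"
begin

lemma mult_M_ge: "n \<ge> 0 \<Longrightarrow> n \<le> M * n"
  using M_pos mult_right_mono[of 1 M n] by simp

text \<open>Join \<open>x\<close> and \<open>y\<close> by a long run of \<open>p\<close>. If the junctions were periodic for all long
  runs, they would all coincide, since they share the left tail of \<open>x\<close>; but they converge to \<open>x\<close>.\<close>

lemma tails_match:
  assumes x: "x \<in> X'" "\<And>i. i \<ge> a \<Longrightarrow> x i = p i" and y: "y \<in> X'" "\<And>i. i \<le> b \<Longrightarrow> y i = p i"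
    and u: "u \<ge> a + C" and v: "u + M * t \<le> b - C"
  shows "f y (u + M * t) = f x u"
proof -
  let ?v = "u + M * t"
  \<comment> \<open>The copy of \<open>y\<close> is moved right by \<open>2 * M * n\<close>, a
    multiple of the period, so its left tail is still \<open>p\<close> in phase. The cut at
    \<open>M * n\<close> is half-way, so it recedes from the windows of both \<open>x\<close> and
    \<open>y\<close>.\<close>
  define z where "z n = (\<lambda>i. if i < M * n then x i else translate (- 2 * M * n) y i)" for n
  obtain L where L: "L \<ge> 0" "\<And>x y a. x \<in> X \<Longrightarrow> y \<in> X \<Longrightarrow> (\<And>i. a \<le> i \<Longrightarrow> i < a + L \<Longrightarrow> x i = y i) \<Longrightarrow>
     (\<lambda>i. if i < a then x i else y i) \<in> X" using gluing by metis
  have p_shift: "p (i - 2 * M * n) = p i" for i n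
    using has_periodD[OF p_period, of i "- 2 * n"] by (simp add: algebra_simps)
  have zX: "z n \<in> X" if n: "n \<ge> \<bar>a\<bar> + \<bar>b\<bar> + L" for n
  proof -
    have Mn: "M * n \<ge> \<bar>a\<bar> + \<bar>b\<bar> + L" using mult_M_ge[of n] n L(1) by linarith
    have "x i = translate (- 2 * M * n) y i" if i: "M * n \<le> i" "i < M * n + L" for i
    proof -
      have "x i = p i" using x(2) i Mn L(1) by simp
      moreover have "y (i - 2 * M * n) = p (i - 2 * M * n)" using y(2) i Mn by simp
      ultimately show ?thesis using p_shift by (simp add: translate_def)
    qed
    then show ?thesis
      unfolding z_def using x(1) y(1) translate_X X'_iff by (intro L(2)) auto
  qed
  have "\<exists>n\<ge>K. \<not> periodic_point (z n)" if "K \<ge> 0" for K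
  proof (rule ccontr)
    assume "\<not> ?thesis"
    then have per: "periodic_point (z n)" if "n \<ge> K" for n using that by blast
    have eq: "z n = z K" if n: "n \<ge> K" for n
    proof (rule periodic_eq_left_tail[OF per[OF n] per[OF order_refl]])
      fix i assume i: "i < M * K"
      have "M * K \<le> M * n" using n M_pos by simp
      then show "z n i = z K i" using i by (simp add: z_def)
    qed
    have "x i = z K i" for i
    proof -
      define n where "n = K + \<bar>i\<bar> + 1"
      have "i < M * n" using mult_M_ge[of n] n_def \<open>K \<ge> 0\<close> by linarith
      then have "x i = z n i" by (simp add: z_def)
      also have "z n = z K" by (rule eq) (simp add: n_def)
      finally show ?thesis .
    qed
    then have "x = z K" by blast
    then show False using per[of K] x(1) X'_iff by simp
  qed
  note nonper = this
  obtain N1 where N1: "\<And>w. w \<in> X' \<Longrightarrow> agree N1 x w \<Longrightarrow> agree \<bar>u\<bar> (f x) (f w)"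
    using f_local x(1) unfolding locally_determined_def by blast
  obtain N2 where N2: "\<And>w. w \<in> X' \<Longrightarrow> agree N2 y w \<Longrightarrow> agree \<bar>?v\<bar> (f y) (f w)"
    using f_local y(1) unfolding locally_determined_def by blast
  \<comment> \<open>Large enough for gluing, and for the cut to avoid the windows on which
    \<open>x\<close> and \<open>y\<close> determine \<open>f x u\<close> and
    \<open>f y ?v\<close>.\<close>
  define K where "K = \<bar>a\<bar> + \<bar>b\<bar> + L + \<bar>N1\<bar> + \<bar>N2\<bar> + \<bar>u\<bar> + \<bar>?v\<bar> + C + 1"
  have "K \<ge> 0" using L(1) C_nonneg by (simp add: K_def)
  then obtain n where n: "n \<ge> K" "\<not> periodic_point (z n)" using nonper by blast
  have Mn: "M * n \<ge> K" using mult_M_ge[of n] n \<open>K \<ge> 0\<close> by linarith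
  define k where "k = M * n"
  have z: "z n i = (if i < k then x i else y (i - 2 * k))" for i
    by (simp add: z_def translate_def k_def mult.assoc)
  have k: "k \<ge> K" using Mn by (simp add: k_def)
  have zX': "z n \<in> X'" using zX[of n] n L(1) C_nonneg by (simp add: X'_iff K_def)
  have "agree N1 x (z n)"
    unfolding agree_def using k L(1) C_nonneg by (auto simp: z K_def)
  then have fx: "f (z n) u = f x u" using N1[OF zX'] by (simp add: agree_def)
  have "agree N2 y (translate (2 * k) (z n))"
    unfolding agree_def translate_def using k L(1) C_nonneg by (auto simp: z K_def)
  then have "agree \<bar>?v\<bar> (f y) (translate (2 * k) (f (z n)))"
    using N2 translate_X'[OF zX'] f_translate[OF zX'] by metis
  then have fy: "f (z n) (?v + 2 * k) = f y ?v" by (simp add: agree_def translate_def)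
  \<comment> \<open>Coordinate \<open>?v\<close> of \<open>y\<close> sits at
    \<open>?v + 2 * k\<close> in \<open>z n\<close>. It and \<open>u\<close> lie at distance at
    least \<open>C\<close> from the ends of the single run of \<open>p\<close> from \<open>a\<close>
    to \<open>b + 2 * k\<close>.\<close>
  have "f (z n) (u + M * (t + 2 * n)) = f (z n) u"
  proof (rule run[OF zX', of a "b + 2 * k"])
    fix i assume i: "a \<le> i" "i \<le> b + 2 * k"
    show "z n i = p i"
      using i x(2) y(2)[of "i - 2 * k"] p_shift[of i n] by (simp add: z k_def mult.assoc)
  next
    show "u \<in> {a + C..b + 2 * k - C}" using u k L(1) C_nonneg unfolding K_def by auto
    have "u + M * (t + 2 * n) = ?v + 2 * k" by (simp add: k_def algebra_simps)
    then show "u + M * (t + 2 * n) \<in> {a + C..b + 2 * k - C}"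
      using v k L(1) C_nonneg unfolding K_def by auto
  qed
  moreover have "u + M * (t + 2 * n) = ?v + 2 * k" by (simp add: k_def algebra_simps)
  ultimately show ?thesis using fx fy by simp
qed

text \<open>Every right tail is comparable with every left tail by \<open>tails_match\<close>, so
  one reference point of each kind, \<open>x0\<close> and \<open>y0\<close>, forces a common
  \<open>q\<close>.\<close>

lemma tail_image:
  "\<exists>q. has_period M q \<and>
    (\<forall>x\<in>X'. \<forall>a. (\<forall>i\<ge>a. x i = p i) \<longrightarrow> (\<forall>u\<ge>a + C. f x u = q u)) \<and>
    (\<forall>y\<in>X'. \<forall>b. (\<forall>i\<le>b. y i = p i) \<longrightarrow> (\<forall>v\<le>b - C. f y v = q v))"
proof -
  obtain x0 a where x0: "x0 \<in> X'" "\<And>i. i \<ge> a \<Longrightarrow> x0 i = p i"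
    using nonperiodic_with_periodic_tail(1)[OF p_X p_period M_pos] by blast
  obtain y0 b where y0: "y0 \<in> X'" "\<And>i. i \<le> b \<Longrightarrow> y0 i = p i"
    using nonperiodic_with_periodic_tail(2)[OF p_X p_period M_pos] by blast
  \<comment> \<open>The representative of \<open>v\<close> modulo \<open>M\<close> in the block of
    length \<open>M\<close> starting at \<open>a + C\<close>, where \<open>tails_match\<close>
    begins to apply to \<open>x0\<close>.\<close>
  define r where "r v = a + C + (v - (a + C)) mod M" for v
  define q where "q v = f x0 (r v)" for v
  have "(i + M - (a + C)) mod M = (i - (a + C)) mod M" for i
    using mod_add_self2[of "i - (a + C)" M] by (simp add: algebra_simps)
  then have q: "has_period M q" by (simp add: has_period_def q_def r_def)
  have left: "f y v = q v" if y: "y \<in> X'" "\<forall>i\<le>d. y i = p i" and v: "v \<le> d - C" for y d v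
  proof -
    have eq: "v = r v + M * ((v - (a + C)) div M)"
      using mod_mult_div_eq[of "v - (a + C)" M] by (simp add: r_def)
    have "f y (r v + M * ((v - (a + C)) div M)) = f x0 (r v)"
      by (rule tails_match[OF x0 y(1), where b = d]) (use y(2) v eq M_pos in \<open>auto simp: r_def\<close>)
    then show ?thesis using eq by (simp add: q_def)
  qed
  moreover have "f x u = q u" if x: "x \<in> X'" "\<forall>i\<ge>c. x i = p i" and u: "u \<ge> c + C" for x c u
  proof -
    \<comment> \<open>Moving left by \<open>M * k\<close> takes \<open>u\<close> into the left tail
      of \<open>y0\<close>, where \<open>f y0\<close> is already known to equal
      \<open>q\<close>.\<close>
    define k where "k = \<bar>u\<bar> + \<bar>b\<bar> + C"
    have "u - M * k \<le> b - C" using mult_M_ge[of k] C_nonneg k_def by linarith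
    then have v: "u + M * (- k) \<le> b - C" by simp
    have "f y0 (u + M * (- k)) = f x u"
      using tails_match[OF x(1) _ y0 u v] x(2) by blast
    moreover have "f y0 (u + M * (- k)) = q (u + M * (- k))" using left y0 v by blast
    ultimately show ?thesis using has_periodD[OF q, of u "- k"] by simp
  qed
  ultimately show ?thesis using q by blast
qed

text \<open>Here \<open>e * h\<close> is the place nearest to the origin where \<open>x\<close> and \<open>p\<close> differ, and the sign \<open>e\<close>
  tells on which side of the run it lies.\<close>

lemma limit_on_one_side:
  assumes q: "has_period M q"
    and right: "\<And>x a u. x \<in> X' \<Longrightarrow> (\<And>i. i \<ge> a \<Longrightarrow> x i = p i) \<Longrightarrow> u \<ge> a + C \<Longrightarrow> f x u = q u"
    and left: "\<And>y b v. y \<in> X' \<Longrightarrow> (\<And>i. i \<le> b \<Longrightarrow> y i = p i) \<Longrightarrow> v \<le> b - C \<Longrightarrow> f y v = q v"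
    and e: "e = 1 \<or> e = -1" and n: "n \<ge> 0"
  shows "\<exists>k::nat. \<forall>x\<in>X'. \<forall>h>int k. (\<forall>i. \<bar>i\<bar> < h \<longrightarrow> x i = p i) \<longrightarrow> x (e * h) \<noteq> p (e * h) \<longrightarrow>
    agree n q (f x)"
proof (rule ccontr)
  assume "\<not> ?thesis"
  then have "\<exists>x\<in>X'. \<exists>h>int k. (\<forall>i. \<bar>i\<bar> < h \<longrightarrow> x i = p i) \<and> x (e * h) \<noteq> p (e * h) \<and>
    \<not> agree n q (f x)" for k by blast
  then obtain x h where x: "\<And>k. x k \<in> X'" and h: "\<And>k. h k > int k"
    and eq: "\<And>k i. \<bar>i\<bar> < h k \<Longrightarrow> x k i = p i" and neq: "\<And>k. x k (e * h k) \<noteq> p (e * h k)"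
    and bad: "\<And>k. \<not> agree n q (f (x k))" by metis
  \<comment> \<open>Rounding \<open>e * h k\<close> down to a multiple of \<open>M\<close> keeps the
    phase of \<open>p\<close> under translation. The difference between \<open>x k\<close> and
    \<open>p\<close> at \<open>e * h k\<close> then lands at \<open>r k\<close>, in
    \<open>{0..<M}\<close>.\<close>
  define t where "t k = (e * h k) div M" for k
  define r where "r k = (e * h k) mod M" for k
  have r: "0 \<le> r k" "r k < M" "M * t k = e * h k - r k" for k
    using M_pos by (simp_all add: r_def t_def minus_mod_eq_mult_div)
  have p_shift: "p (i + M * j) = p i" for i j using has_periodD[OF p_period] .
  obtain y where y: "\<And>N K. \<exists>k\<ge>K. agree N y (translate (M * t k) (x k))"
    using config_cluster_point[of "\<lambda>k. translate (M * t k) (x k)"] by blast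
  have "y \<in> X" using closed_X y translate_X x X'_iff by metis
  \<comment> \<open>On the side opposite to \<open>e\<close> the translated runs reach the origin up
    to \<open>M\<close>, a margin that absorbs \<open>r k\<close>, and grow without bound.\<close>
  have tail: "y j = p j" if j: "e * j < - M" for j
  proof -
    obtain k where k: "k \<ge> nat (\<bar>j\<bar> + M)" "agree \<bar>j\<bar> y (translate (M * t k) (x k))" using y by blast
    have "h k > \<bar>j\<bar> + M" using h[of k] k(1) by linarith
    then have "\<bar>j + M * t k\<bar> < h k" using e r[of k] j by auto
    then have "x k (j + M * t k) = p j" using eq p_shift by simp
    then show ?thesis using k(2) by (simp add: agree_def translate_def)
  qed
  \<comment> \<open>All the differences at \<open>r k\<close> lie in one fixed window, so they
    survive in the limit.\<close>
  have "y \<noteq> p"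
  proof
    assume "y = p"
    moreover obtain k where "agree M y (translate (M * t k) (x k))" using y by blast
    ultimately have "p (r k) = x k (r k + M * t k)" using r[of k] by (simp add: agree_def translate_def)
    then have "p (r k + M * t k) = x k (r k + M * t k)" using p_shift by simp
    then show False using neq[of k] r(3)[of k] by simp
  qed
  have pp: "periodic_point p" using p_period M_pos periodic_point_iff by blast
  have "\<not> periodic_point y"
  proof
    assume per: "periodic_point y"
    from e have "y = p"
    proof
      assume "e = 1"
      then show ?thesis using periodic_eq_left_tail[OF per pp, of "- M"] tail by simp
    next
      assume "e = - 1"
      then show ?thesis using periodic_eq_right_tail[OF per pp, of M] tail by simp
    qed
    then show False using \<open>y \<noteq> p\<close> by simp
  qed
  then have yX': "y \<in> X'" using \<open>y \<in> X\<close> by (simp add: X'_iff)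
  have fy: "f y v = q v" if v: "e * v < - M - C" for v
    using e
  proof
    assume "e = 1"
    then show ?thesis using left[OF yX', of "- M - 1" v] tail v by simp
  next
    assume "e = - 1"
    then show ?thesis using right[OF yX', of "M + 1" v] tail v by simp
  qed
  \<comment> \<open>A move by \<open>- e * (M * W)\<close> carries every coordinate of the window of
    radius \<open>n\<close> into the region where \<open>f y\<close> is known to equal
    \<open>q\<close>.\<close>
  define W where "W = n + C + 2"
  have W: "M * W > n + M + C"
    using mult_M_ge[of "n + C + 1"] n C_nonneg by (simp add: W_def algebra_simps)
  obtain N where N: "\<And>w. w \<in> X' \<Longrightarrow> agree N y w \<Longrightarrow> agree (n + M * W) (f y) (f w)"
    using f_local yX' unfolding locally_determined_def by blast
  obtain k where k: "k \<ge> nat (n + C + M + M * W + 1)" "agree N y (translate (M * t k) (x k))"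
    using y by blast
  have hk: "h k > n + C + M + M * W + 1" using h[of k] k(1) by linarith
  have "f (x k) i = q i" if i: "\<bar>i\<bar> \<le> n" for i
  proof -
    \<comment> \<open>At \<open>v\<close> the translate of \<open>f (x k)\<close> agrees with
      \<open>f y\<close>, hence with \<open>q\<close>. Periodicity along the run of
      \<open>x k\<close> carries this back to coordinate \<open>i\<close>.\<close>
    define v where "v = i - e * (M * W)"
    have v: "e * v < - M - C" "\<bar>v\<bar> \<le> n + M * W" using e W i n M_pos C_nonneg by (auto simp: v_def)
    have v_eq: "v = i + M * (- e * W)" by (simp add: v_def)
    have "q v = q i" unfolding v_eq by (rule has_periodD[OF q])
    moreover have "f y v = f (translate (M * t k) (x k)) v"
      using N[OF translate_X'[OF x] k(2)] v(2) by (rule agreeD)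
    then have "f y v = f (x k) (v + M * t k)" using f_translate[OF x] by (simp add: translate_def)
    moreover have "f (x k) (i + M * (t k - e * W)) = f (x k) i"
    proof (rule run[OF x, of "- (h k - 1)" "h k - 1"])
      show "x k j = p j" if "- (h k - 1) \<le> j" "j \<le> h k - 1" for j using eq that by simp
      show "i \<in> {- (h k - 1) + C..h k - 1 - C}" using hk i W n M_pos C_nonneg by auto
      have "i + M * (t k - e * W) = v + (e * h k - r k)"
        using r(3)[of k] by (simp add: v_def algebra_simps)
      moreover from e have "v + (e * h k - r k) \<in> {- (h k - 1) + C..h k - 1 - C}"
      proof
        assume "e = 1"
        then have "v = i - M * W" "e * h k = h k" by (simp_all add: v_def)
        then show ?thesis using r(1,2)[of k] i hk W M_pos C_nonneg n by auto
      next
        assume "e = - 1"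
        then have "v = i + M * W" "e * h k = - h k" by (simp_all add: v_def)
        then show ?thesis using r(1,2)[of k] i hk W M_pos C_nonneg n by auto
      qed
      ultimately show "i + M * (t k - e * W) \<in> {- (h k - 1) + C..h k - 1 - C}" by simp
    qed
    moreover have "i + M * (t k - e * W) = v + M * t k" by (simp add: v_def algebra_simps)
    ultimately show ?thesis using fy[OF v(1)] by simp
  qed
  then show False using bad[of k] by (simp add: agree_def)
qed

text \<open>The nearest difference between \<open>x\<close> and \<open>p\<close> may lie on either
  side of the origin, so \<open>limit_on_one_side\<close> is used with both signs.\<close>

lemma limit_at_run_point: "\<exists>q. \<forall>n. \<exists>N. \<forall>x\<in>X'. agree N p x \<longrightarrow> agree n q (f x)"
proof -
  obtain q where q: "has_period M q"
    and right: "\<And>x a u. x \<in> X' \<Longrightarrow> (\<And>i. i \<ge> a \<Longrightarrow> x i = p i) \<Longrightarrow> u \<ge> a + C \<Longrightarrow> f x u = q u"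
    and left: "\<And>y b v. y \<in> X' \<Longrightarrow> (\<And>i. i \<le> b \<Longrightarrow> y i = p i) \<Longrightarrow> v \<le> b - C \<Longrightarrow> f y v = q v"
    using tail_image by blast
  have "\<exists>N. \<forall>x\<in>X'. agree N p x \<longrightarrow> agree n q (f x)" for n
  proof -
    have good: "\<exists>k::nat. \<forall>x\<in>X'. \<forall>h>int k. (\<forall>i. \<bar>i\<bar> < h \<longrightarrow> x i = p i) \<longrightarrow>
        x (e * h) \<noteq> p (e * h) \<longrightarrow> agree \<bar>n\<bar> q (f x)" if "e = 1 \<or> e = -1" for e
      by (rule limit_on_one_side[OF q right left that abs_ge_zero])
    obtain k1 :: nat where k1: "\<And>x h. x \<in> X' \<Longrightarrow> h > int k1 \<Longrightarrow> (\<And>i. \<bar>i\<bar> < h \<Longrightarrow> x i = p i) \<Longrightarrow>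
        x h \<noteq> p h \<Longrightarrow> agree \<bar>n\<bar> q (f x)" using good[of 1] by auto
    obtain k2 :: nat where k2: "\<And>x h. x \<in> X' \<Longrightarrow> h > int k2 \<Longrightarrow> (\<And>i. \<bar>i\<bar> < h \<Longrightarrow> x i = p i) \<Longrightarrow>
        x (- h) \<noteq> p (- h) \<Longrightarrow> agree \<bar>n\<bar> q (f x)" using good[of "-1"] by auto
    have "agree n q (f x)" if x: "x \<in> X'" "agree (int (k1 + k2)) p x" for x
    proof -
      have "x \<noteq> p" using x(1) X'_iff p_period M_pos periodic_point_iff by blast
      then obtain j where j: "x j \<noteq> p j" by blast
      \<comment> \<open>The distance from the origin to the nearest difference; one exists because
        \<open>p\<close> is periodic and \<open>x\<close> is not.\<close>
      define h where "h = (LEAST h. x (int h) \<noteq> p (int h) \<or> x (- int h) \<noteq> p (- int h))"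
      have "x (int (nat \<bar>j\<bar>)) \<noteq> p (int (nat \<bar>j\<bar>)) \<or> x (- int (nat \<bar>j\<bar>)) \<noteq> p (- int (nat \<bar>j\<bar>))"
        using j by (cases "j \<ge> 0") auto
      then have h: "x (int h) \<noteq> p (int h) \<or> x (- int h) \<noteq> p (- int h)"
        unfolding h_def by (rule LeastI)
      have less: "x i = p i" if "\<bar>i\<bar> < int h" for i
      proof -
        have "nat \<bar>i\<bar> < h" using that by linarith
        then have "\<not> (x (int (nat \<bar>i\<bar>)) \<noteq> p (int (nat \<bar>i\<bar>)) \<or> x (- int (nat \<bar>i\<bar>)) \<noteq> p (- int (nat \<bar>i\<bar>)))"
          unfolding h_def by (rule not_less_Least)
        then show ?thesis by (cases "i \<ge> 0") auto
      qed
      have "int h > int (k1 + k2)"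
      proof (rule ccontr)
        assume "\<not> ?thesis"
        then have "\<bar>int h\<bar> \<le> int (k1 + k2)" "\<bar>- int h\<bar> \<le> int (k1 + k2)" by auto
        then show False using h agreeD[OF x(2)] by metis
      qed
      then have "int k1 < int h" "int k2 < int h" by auto
      then have "agree \<bar>n\<bar> q (f x)"
        using h k1[OF x(1), of "int h"] k2[OF x(1), of "int h"] less by blast
      then show ?thesis by (rule agree_mono) simp
    qed
    then show ?thesis by blast
  qed
  then show ?thesis by blast
qed

end

text \<open>At a non-periodic point continuity of \<open>f\<close> gives the limit
  \<open>f x\<close>; only periodic points need the analysis of runs.\<close>

lemma limit_exists:
  assumes "x \<in> X"
  shows "\<exists>y. \<forall>n. \<exists>N. \<forall>x'\<in>X'. agree N x x' \<longrightarrow> agree n y (f x')"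
proof (cases "periodic_point x")
  case True
  then obtain m where m: "has_period m x" "m > 0" using periodic_point_iff by blast
  obtain M C where *: "M > 0" "C \<ge> 0" "has_period M x"
    "\<And>y a b i t. y \<in> X' \<Longrightarrow> (\<And>k. a \<le> k \<Longrightarrow> k \<le> b \<Longrightarrow> y k = x k) \<Longrightarrow>
      i \<in> {a + C..b - C} \<Longrightarrow> i + M * t \<in> {a + C..b - C} \<Longrightarrow> f y (i + M * t) = f y i"
    using periodic_run[OF m] by blast
  show ?thesis by (rule limit_at_run_point) (fact assms *)+
next
  case False
  then have "x \<in> X'" using assms by (simp add: X'_iff)
  then show ?thesis using f_local unfolding locally_determined_def by blast
qed

end

section \<open>Density of non-periodic points and extension by continuity\<close>

context transitive_sft
begin

text \<open>A non-periodic point whose right tail is that of a periodic \<open>x\<close> agrees with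
  \<open>x\<close> on any given window after translation by a large multiple of the period.\<close>

lemma nonperiodic_dense:
  assumes "x \<in> X"
  shows "\<exists>x'\<in>X'. agree n x x'"
proof (cases "periodic_point x")
  case True
  then obtain m where m: "has_period m x" "m > 0" using periodic_point_iff by blast
  obtain y a where y: "y \<in> X'" "\<And>i. i \<ge> a \<Longrightarrow> y i = x i"
    using nonperiodic_with_periodic_tail(1)[OF assms m] by blast
  define k where "k = \<bar>a\<bar> + \<bar>n\<bar>"
  have "m * k \<ge> k" using m(2) mult_right_mono[of 1 m k] by (simp add: k_def)
  then have "y (i + m * k) = x i" if "\<bar>i\<bar> \<le> n" for i
    using y(2)[of "i + m * k"] has_periodD[OF m(1)] that unfolding k_def[symmetric] by (simp add: k_def)
  then have "agree n x (translate (m * k) y)" by (simp add: agree_def translate_def)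
  then show ?thesis using translate_X' y(1) by blast
next
  case False
  then show ?thesis using assms X'_iff agree_refl by blast
qed

lemma extension_exists:
  assumes f: "f \<in> X' \<rightarrow> X'" "locally_determined X' f" "\<And>x. x \<in> X' \<Longrightarrow> f (shift x) = shift (f x)"
    and lim: "\<And>x. x \<in> X \<Longrightarrow> \<exists>y. \<forall>n. \<exists>N. \<forall>x'\<in>X'. agree N x x' \<longrightarrow> agree n y (f x')"
  shows "\<exists>F\<in>X \<rightarrow> X. locally_determined X F \<and> (\<forall>x\<in>X'. F x = f x) \<and> (\<forall>x\<in>X. F (shift x) = shift (F x))"
proof -
  obtain F where F: "\<And>x n. x \<in> X \<Longrightarrow> \<exists>N. \<forall>x'\<in>X'. agree N x x' \<longrightarrow> agree n (F x) (f x')"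
    using lim by metis
  have F_local: "locally_determined X F"
    unfolding locally_determined_def
  proof (intro ballI allI)
    fix x n assume "x \<in> X"
    then obtain N where N: "\<And>x'. x' \<in> X' \<Longrightarrow> agree N x x' \<Longrightarrow> agree n (F x) (f x')" using F by blast
    have "agree n (F x) (F y)" if y: "y \<in> X" "agree N x y" for y
    proof -
      obtain N' where N': "\<And>x'. x' \<in> X' \<Longrightarrow> agree N' y x' \<Longrightarrow> agree n (F y) (f x')"
        using F[OF y(1)] by blast
      \<comment> \<open>A non-periodic point this close to \<open>y\<close> also lies in the
        neighbourhood of \<open>x\<close>, so \<open>f z\<close> is close to both \<open>F x\<close>
        and \<open>F y\<close>.\<close>
      obtain z where z: "z \<in> X'" "agree (max N N') y z" using nonperiodic_dense[OF y(1)] by blast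
      have "agree N x z" "agree N' y z"
        using z(2) y(2) agree_mono agree_trans by (metis max.cobounded1, metis max.cobounded2)
      then show ?thesis using N N' z(1) agree_trans agree_sym by meson
    qed
    then show "\<exists>N. \<forall>y\<in>X. agree N x y \<longrightarrow> agree n (F x) (F y)" by blast
  qed
  have FX: "F x \<in> X" if x: "x \<in> X" for x
  proof (rule closed_X)
    fix n
    obtain N where "\<And>x'. x' \<in> X' \<Longrightarrow> agree N x x' \<Longrightarrow> agree n (F x) (f x')" using F[OF x] by blast
    then show "\<exists>y\<in>X. agree n (F x) y" using nonperiodic_dense[OF x, of N] f(1) X'_iff by blast
  qed
  have ext: "F x = f x" if "x \<in> X'" for x
    by (rule agree_all_eq) (metis F X'_iff agree_refl that)
  have "F (shift x) = shift (F x)" if x: "x \<in> X" for x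
  proof (rule agree_all_eq)
    fix n
    have sx: "shift x \<in> X" using x translate_X shift_eq_translate by metis
    obtain N1 where N1: "\<And>y. y \<in> X' \<Longrightarrow> agree N1 (shift x) y \<Longrightarrow> agree n (F (shift x)) (f y)"
      using F[OF sx] by blast
    obtain N2 where N2: "\<And>y. y \<in> X' \<Longrightarrow> agree N2 x y \<Longrightarrow> agree (n + 1) (F x) (f y)"
      using F[OF x] by blast
    obtain y where y: "y \<in> X'" "agree (max (N1 + 1) N2) x y" using nonperiodic_dense[OF x] by blast
    have "agree N1 (shift x) (shift y)"
      using agree_translate[of N1 1 x y] agree_mono[OF y(2)] by (simp add: shift_eq_translate)
    then have "agree n (F (shift x)) (shift (f y))"
      using N1[of "shift y"] f(3) y(1) translate_X' shift_eq_translate by metis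
    moreover have "agree (n + 1) (F x) (f y)" using N2[OF y(1)] agree_mono[OF y(2)] by simp
    then have "agree n (shift (F x)) (shift (f y))"
      using agree_translate[of n 1 "F x" "f y"] by (simp add: shift_eq_translate)
    ultimately show "agree n (F (shift x)) (shift (F x))" using agree_trans agree_sym by blast
  qed
  then show ?thesis using F_local FX ext by (intro bexI[of _ F]) auto
qed

text \<open>Continuous maps agreeing on a dense subset are equal. This gives injectivity of
  restriction and shows that extensions of mutually inverse maps are mutually inverse.\<close>

lemma extension_unique:
  assumes F: "locally_determined X F" and G: "locally_determined X G"
    and eq: "\<And>x. x \<in> X' \<Longrightarrow> F x = G x" and x: "x \<in> X"
  shows "F x = G x"
proof (rule agree_all_eq)
  fix n
  obtain N1 where N1: "\<And>y. y \<in> X \<Longrightarrow> agree N1 x y \<Longrightarrow> agree n (F x) (F y)"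
    using F x unfolding locally_determined_def by blast
  obtain N2 where N2: "\<And>y. y \<in> X \<Longrightarrow> agree N2 x y \<Longrightarrow> agree n (G x) (G y)"
    using G x unfolding locally_determined_def by blast
  obtain y where y: "y \<in> X'" "agree (max N1 N2) x y" using nonperiodic_dense[OF x] by blast
  have "agree n (F x) (F y)" "agree n (G x) (G y)"
    using N1 N2 y(1) agree_mono[OF y(2)] by (simp_all add: X'_iff)
  then show "agree n (F x) (G x)" using eq[OF y(1)] agree_trans agree_sym by metis
qed

lemma locally_determined_compose:
  assumes "locally_determined S F" "locally_determined S G" "G \<in> S \<rightarrow> S"
  shows "locally_determined S (\<lambda>x. F (G x))"
  unfolding locally_determined_def
proof (intro ballI allI)
  fix x n assume x: "x \<in> S"
  then obtain N where "\<forall>y\<in>S. agree N (G x) y \<longrightarrow> agree n (F (G x)) (F y)"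
    using assms(1,3) unfolding locally_determined_def by blast
  moreover obtain N' where "\<forall>y\<in>S. agree N' x y \<longrightarrow> agree N (G x) (G y)"
    using assms(2) x unfolding locally_determined_def by blast
  ultimately show "\<exists>N. \<forall>y\<in>S. agree N x y \<longrightarrow> agree n (F (G x)) (F (G y))"
    using assms(3) by blast
qed

end

text \<open>Applied to the inverse of an automorphism, this shows that non-periodic points have
  non-periodic images.\<close>

lemma commuting_image_periodic:
  assumes f: "f \<in> S \<rightarrow> S" "\<And>x. x \<in> S \<Longrightarrow> f (shift x) = shift (f x)"
    and S: "shift ` S \<subseteq> S" and x: "x \<in> S" "periodic_point x"
  shows "periodic_point (f x)"
proof -
  have "(shift ^^ n) x \<in> S \<and> f ((shift ^^ n) x) = (shift ^^ n) (f x)" for n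
    using f(2) S x(1) by (induction n) auto
  then show ?thesis using x(2) unfolding periodic_point_def by metis
qed

lemma inverse_commutes:
  assumes "f \<in> S \<rightarrow> S" "g \<in> S \<rightarrow> S" "\<And>x. x \<in> S \<Longrightarrow> f (shift x) = shift (f x)"
    "\<And>x. x \<in> S \<Longrightarrow> g (f x) = x" "\<And>x. x \<in> S \<Longrightarrow> f (g x) = x" "shift ` S \<subseteq> S" "x \<in> S"
  shows "g (shift x) = shift (g x)"
proof -
  have "g x \<in> S" using assms(2,7) by blast
  then have "shift (g x) \<in> S" using assms(6) by blast
  then have "g (f (shift (g x))) = shift (g x)" by (rule assms(4))
  then show ?thesis using assms(3)[OF \<open>g x \<in> S\<close>] assms(5)[OF assms(7)] by simp
qed

section \<open>Restriction as an isomorphism of automorphism groups\<close>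

context transitive_sft
begin

lemma shift_X: "shift ` X \<subseteq> X"
  using shift_subshift subshift_of_finite_type_imp_subshift sft by blast

lemma restrict_automorphism:
  assumes "f \<in> shift_automorphisms X"
  shows "restrict f X' \<in> shift_automorphisms X'"
proof -
  obtain g where f: "f \<in> X \<rightarrow> X" "locally_determined X f" "\<And>x. x \<in> X \<Longrightarrow> f (shift x) = shift (f x)"
    and g: "g \<in> X \<rightarrow> X" "locally_determined X g" "\<And>x. x \<in> X \<Longrightarrow> g (f x) = x"
      "\<And>x. x \<in> X \<Longrightarrow> f (g x) = x"
    using assms unfolding shift_automorphisms_iff by blast
  have g_shift: "g (shift x) = shift (g x)" if "x \<in> X" for x
    using inverse_commutes[OF f(1) g(1) f(3) g(3,4) shift_X that] .
  have fX': "f x \<in> X'" if "x \<in> X'" for x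
    using that commuting_image_periodic[OF g(1) g_shift shift_X, of "f x"] f(1) g(3)
    unfolding X'_iff by (metis funcset_mem)
  have gX': "g x \<in> X'" if "x \<in> X'" for x
    using that commuting_image_periodic[OF f(1) f(3) shift_X, of "g x"] g(1) g(4)
    unfolding X'_iff by (metis funcset_mem)
  have loc: "locally_determined X' (restrict h X')" if "locally_determined X h" for h
    unfolding locally_determined_def
  proof (intro ballI allI)
    fix x n assume x: "x \<in> X'"
    then obtain N where "\<And>y. y \<in> X \<Longrightarrow> agree N x y \<Longrightarrow> agree n (h x) (h y)"
      using \<open>locally_determined X h\<close> X'_iff unfolding locally_determined_def by blast
    then have "\<forall>y\<in>X'. agree N x y \<longrightarrow> agree n (restrict h X' x) (restrict h X' y)"
      using x X'_iff by simp
    then show "\<exists>N. \<forall>y\<in>X'. agree N x y \<longrightarrow> agree n (restrict h X' x) (restrict h X' y)" ..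
  qed
  have shX': "shift x \<in> X'" if "x \<in> X'" for x
    using that translate_X' by (simp add: shift_eq_translate)
  show ?thesis
    unfolding shift_automorphisms_iff
  proof (intro conjI ballI bexI[of _ "restrict g X'"])
    show "restrict f X' (shift x) = shift (restrict f X' x)" if "x \<in> X'" for x
      using that shX' f(3) X'_iff by simp
    show "restrict g X' (restrict f X' x) = x" "restrict f X' (restrict g X' x) = x" if "x \<in> X'" for x
      using that fX' gX' g(3,4) X'_iff by simp_all
  qed (use fX' gX' loc f(2) g(2) in auto)
qed

lemma extend_automorphism:
  assumes "f \<in> shift_automorphisms X'"
  shows "\<exists>F\<in>shift_automorphisms X. restrict F X' = f"
proof -
  have shX': "shift ` X' \<subseteq> X'" using shift_nonperiodic_part[OF shift_X] .
  obtain g where f: "f \<in> X' \<rightarrow> X'" "locally_determined X' f" "f \<in> extensional X'"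
      "\<And>x. x \<in> X' \<Longrightarrow> f (shift x) = shift (f x)"
    and g: "g \<in> X' \<rightarrow> X'" "locally_determined X' g" "\<And>x. x \<in> X' \<Longrightarrow> g (f x) = x"
      "\<And>x. x \<in> X' \<Longrightarrow> f (g x) = x"
    using assms unfolding shift_automorphisms_iff by blast
  have g_shift: "g (shift x) = shift (g x)" if "x \<in> X'" for x
    using inverse_commutes[OF f(1) g(1) f(4) g(3,4) shX' that] .
  interpret fg: nonperiodic_automorphism X f g
    using f g by unfold_locales auto
  \<comment> \<open>Since \<open>g\<close> commutes with the shift too, the roles of
    \<open>f\<close> and \<open>g\<close> can be exchanged, and \<open>g\<close> also has limits at
    periodic points.\<close>
  interpret gf: nonperiodic_automorphism X g f
    using f g g_shift by unfold_locales auto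
  obtain F where F: "F \<in> X \<rightarrow> X" "locally_determined X F" "\<And>x. x \<in> X' \<Longrightarrow> F x = f x"
      "\<And>x. x \<in> X \<Longrightarrow> F (shift x) = shift (F x)"
    using extension_exists[OF f(1,2,4) fg.limit_exists] by blast
  obtain G where G: "G \<in> X \<rightarrow> X" "locally_determined X G" "\<And>x. x \<in> X' \<Longrightarrow> G x = g x"
    using extension_exists[OF g(1,2) g_shift gf.limit_exists] by blast
  have id: "locally_determined X (\<lambda>x. x)" unfolding locally_determined_def by blast
  have GF: "G (F x) = x" if "x \<in> X" for x
    by (rule extension_unique[OF locally_determined_compose[OF G(2) F(2,1)] id _ that])
      (simp add: F(3) G(3) fg.f_X' g(3))
  have FG: "F (G x) = x" if "x \<in> X" for x
    by (rule extension_unique[OF locally_determined_compose[OF F(2) G(2,1)] id _ that])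
      (simp add: F(3) G(3) fg.g_X' g(4))
  \<comment> \<open>The values of \<open>F\<close> outside \<open>X\<close> are arbitrary, whereas
    members of \<open>shift_automorphisms X\<close> are extensional.\<close>
  have "restrict F X \<in> shift_automorphisms X"
    unfolding shift_automorphisms_iff
  proof (intro conjI bexI[of _ G] ballI)
    show "locally_determined X (restrict F X)" using F(2) by (simp add: locally_determined_def)
    show "restrict F X (shift x) = shift (restrict F X x)" if "x \<in> X" for x
      using that shift_X F(4) by (simp add: image_subset_iff)
    show "G (restrict F X x) = x" "restrict F X (G x) = x" if "x \<in> X" for x
      using that GF FG G(1) by auto
  qed (use F(1) G in auto)
  moreover have "restrict (restrict F X) X' = f"
    by (rule ext) (use f(3) F(3) X'_iff in \<open>auto simp: restrict_def extensional_def\<close>)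
  ultimately show ?thesis by blast
qed

text \<open>The isomorphism is restriction to \<open>X'\<close>: injective by
  \<open>extension_unique\<close>, surjective by \<open>extend_automorphism\<close>.\<close>

lemma Aut_iso_Aut_nonperiodic: "Aut X \<cong> Aut X'"
proof -
  define \<Phi> where "\<Phi> f = restrict f X'" for f :: "'a config \<Rightarrow> 'a config"
  have carrier: "carrier (Aut S) = shift_automorphisms S" for S :: "'a config set"
    by (simp add: Aut_def)
  have hom: "\<Phi> \<in> hom (Aut X) (Aut X')"
  proof (rule homI)
    fix f assume "f \<in> carrier (Aut X)"
    then show "\<Phi> f \<in> carrier (Aut X')" using restrict_automorphism by (simp add: carrier \<Phi>_def)
  next
    fix f h assume f: "f \<in> carrier (Aut X)" and h: "h \<in> carrier (Aut X)"
    have f': "\<Phi> f \<in> carrier (Aut X')" and h': "\<Phi> h \<in> carrier (Aut X')"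
      using f h restrict_automorphism by (simp_all add: carrier \<Phi>_def)
    have "h x \<in> X'" if "x \<in> X'" for x
      using h' that unfolding carrier shift_automorphisms_iff \<Phi>_def by (metis funcset_mem restrict_apply')
    then have "\<Phi> (compose X f h) = compose X' (\<Phi> f) (\<Phi> h)"
      by (auto simp: \<Phi>_def compose_def X'_iff fun_eq_iff)
    then show "\<Phi> (f \<otimes>\<^bsub>Aut X\<^esub> h) = \<Phi> f \<otimes>\<^bsub>Aut X'\<^esub> \<Phi> h"
      using f h f' h' by (simp add: mult_Aut)
  qed
  have "bij_betw \<Phi> (carrier (Aut X)) (carrier (Aut X'))"
    unfolding bij_betw_def
  proof (intro conjI inj_onI equalityI subsetI)
    fix f h assume f: "f \<in> carrier (Aut X)" and h: "h \<in> carrier (Aut X)" and eq: "\<Phi> f = \<Phi> h"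
    have ext: "f \<in> extensional X" "h \<in> extensional X" and "locally_determined X f" "locally_determined X h"
      using f h unfolding carrier shift_automorphisms_iff by blast+
    moreover have "f x = h x" if "x \<in> X'" for x
      using fun_cong[OF eq, of x] that by (simp add: \<Phi>_def)
    ultimately show "f = h" using extension_unique[of f h] by (intro extensionalityI[OF ext]) blast
  next
    fix f assume "f \<in> \<Phi> ` carrier (Aut X)"
    then show "f \<in> carrier (Aut X')" using restrict_automorphism by (auto simp: carrier \<Phi>_def)
  next
    fix f assume "f \<in> carrier (Aut X')"
    then show "f \<in> \<Phi> ` carrier (Aut X)" using extend_automorphism by (auto simp: carrier \<Phi>_def)
  qed
  then show ?thesis using hom unfolding is_iso_def iso_def by blast
qed

end

theorem theorem2:
  fixes X :: "(int \<Rightarrow> 'a::finite) set"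
  assumes "subshift_of_finite_type X"
    and "transitive_shift X"
    and "infinite X"
  shows "Aut X \<cong> Aut (nonperiodic_part X)"
proof -
  interpret transitive_sft X using assms by unfold_locales
  show ?thesis by (rule Aut_iso_Aut_nonperiodic)
qed

end
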